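(* Let $\rho>0$ and $\theta^0\in\mathbb{R}^{R\times T}$ be arbitrary, and let $\{p^k\}_{k\ge 0}\subset\mathbb{R}^R$ be the sequence generated by the Method of Averaged Marginals (MAM, described in the context), where $\gamma=\infty$ if the measures $\nu^{(1)},\ldots,\nu^{(M)}$ are balanced, and $\gamma\in(0,\infty)$ is a chosen constant otherwise. a) (Deterministic MAM.) If $\mathcal{M}^k=\{1,\ldots,M\}$ for all $k$, then the sequence $\{p^k\}$ converges to a point $\bar p$. If the measures are balanced, then $\bar p$ is a balanced Wasserstein barycenter; otherwise, $\bar p$ is a $\gamma$-unbalanced Wasserstein barycenter. b) (Randomized MAM.) Let $1<n_b<M$, let $A_1,\ldots,A_{n_b}$ be a partition of $\{1,\ldots,M\}$ such that $\beta_i:=\sum_{m\in A_i}\alpha_m>0$ for all $i$, and suppose that at every iteration $k$ an index $i\in\{1,\ldots,n_b\}$ is drawn (independently of the previous draws) with probability $\beta_i$ and $\mathcal{M}^k:=A_i$. Then the sequence $\{p^k\}$ converges almost surely to a point $\bar p$ (a random variable). If the measures are balanced, then $\bar p$ is almost surely a balanced Wasserstein barycenter; otherwise, $\bar p$ is almost surely a $\gamma$-unbalanced Wasserstein barycenter.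
   Context: **Data.** For $\tau\ge 0$, $\Delta_R(\tau):=\{u\in\mathbb{R}^R_+:\sum_{i=1}^R u_i=\tau\}$, and $\Delta_M$ means $\Delta_M(1)$. We are given weights $\alpha\in\Delta_M$, finitely supported nonnegative measures $\nu^{(m)}=\sum_{s=1}^{S^{(m)}}q^{(m)}_s\delta_{\zeta^{(m)}_s}$ on $\mathbb{R}^d$ with $q^{(m)}\in\mathbb{R}^{S^{(m)}}_+$, $m=1,\ldots,M$, and a finite set of points $\xi_1,\ldots,\xi_R\in\mathbb{R}^d$ (candidate support of the barycenter). Let $T:=\sum_{m=1}^M S^{(m)}$; an element $\theta\in\mathbb{R}^{R\times T}$ is written $\theta=(\theta^{(1)},\ldots,\theta^{(M)})$ with $\theta^{(m)}\in\mathbb{R}^{R\times S^{(m)}}$. The cost is $c^{(m)}_{rs}:=\alpha_m\|\xi_r-\zeta^{(m)}_s\|^2$. All norms are Euclidean and $\mathrm{Proj}_C$ is Euclidean projection onto a closed convex set $C$. The measures are called balanced if all totals $\sum_{s}q^{(m)}_s$, $m=1,\ldots,M$, equal a common value $\tau$ (e.g. $\tau=1$ for probability measures), and unbalanced otherwise. **Sets.** $\Pi^{(m)}:=\{\pi^{(m)}\in\mathbb{R}^{R\times S^{(m)}}:\pi^{(m)}\ge 0,\ \sum_{r=1}^R\pi^{(m)}_{rs}=q^{(m)}_s,\ s=1,\ldots,S^{(m)}\}$. The linear subspace $\mathcal{B}\subset\mathbb{R}^{R\times T}$ consists of all $\pi=(\pi^{(1)},\ldots,\pi^{(M)})$ with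 $\sum_{s=1}^{S^{(m)}}\pi^{(m)}_{rs}=\sum_{s=1}^{S^{(m+1)}}\pi^{(m+1)}_{rs}$ for all $r=1,\ldots,R$ and $m=1,\ldots,M-1$. Let $\mathrm{dist}_{\mathcal{B}}(\pi):=\min_{\theta\in\mathcal{B}}\|\theta-\pi\|$. **Balanced Wasserstein barycenter.** In the balanced case, $\bar p$ is called a balanced Wasserstein barycenter if there is $\pi\ge 0$ such that $(\bar p,\pi)$ solves the linear program $$\min_{p\in\Delta_R(\tau),\,\pi\ge 0}\ \sum_{m=1}^M\sum_{r=1}^R\sum_{s=1}^{S^{(m)}}c^{(m)}_{rs}\pi^{(m)}_{rs}\quad\text{s.t.}\quad \sum_{r=1}^R\pi^{(m)}_{rs}=q^{(m)}_s\ \ \forall s,m,\qquad \sum_{s=1}^{S^{(m)}}\pi^{(m)}_{rs}=p_r\ \ \forall r,m$$ (identifying $\bar p$ with the measure $\sum_r\bar p_r\delta_{\xi_r}$). **$\gamma$-unbalanced Wasserstein barycenter.** Let $\bar\pi$ be a solution of $$\min_{\pi}\ \sum_{m=1}^M\sum_{r=1}^R\sum_{s=1}^{S^{(m)}}c^{(m)}_{rs}\pi^{(m)}_{rs}+\gamma\,\mathrm{dist}_{\mathcal{B}}(\pi)\quad\text{s.t.}\quad \pi^{(m)}\in\Pi^{(m)},\ m=1,\ldots,M,$$ and $\tilde\pi:=\mathrm{Proj}_{\mathcal{B}}(\bar\pi)$. The vector $p$ with $p_r:=\sum_{s=1}^{S^{(m)}}\tilde\pi^{(m)}_{rs}$ (independent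 of $m$), identified with the measure $\sum_r p_r\delta_{\xi_r}$, is called a $\gamma$-unbalanced Wasserstein barycenter. **MAM algorithm.** Set $a_m:=\frac{1/S^{(m)}}{\sum_{j=1}^M 1/S^{(j)}}$. Initialize $p^{(m)}_r:=\sum_{s=1}^{S^{(m)}}\theta^{(m),0}_{rs}$ for all $r,m$. For $k=0,1,2,\ldots$: 1. Compute $p^k:=\sum_{m=1}^M a_m p^{(m)}$. Let $D^k:=\sqrt{\sum_{m=1}^M\|p^k-p^{(m)}\|^2/S^{(m)}}$. Set $t^k:=1$ if $\rho D^k\le\gamma$, and $t^k:=\gamma/(\rho D^k)$ otherwise. 2. Choose an index set $\emptyset\ne\mathcal{M}^k\subseteq\{1,\ldots,M\}$. For each $m\in\mathcal{M}^k$ and each $s=1,\ldots,S^{(m)}$: define $w\in\mathbb{R}^R$ by $w_r:=\theta^{(m),k}_{rs}+2t^k\frac{p^k_r-p^{(m)}_r}{S^{(m)}}-\frac1\rho c^{(m)}_{rs}$; compute $(\hat\pi^{(m)}_{1s},\ldots,\hat\pi^{(m)}_{Rs}):=\mathrm{Proj}_{\Delta_R(q^{(m)}_s)}(w)$; set $\theta^{(m),k+1}_{rs}:=\hat\pi^{(m)}_{rs}-t^k\frac{p^k_r-p^{(m)}_r}{S^{(m)}}$, $r=1,\ldots,R$. For $m\notin\mathcal{M}^k$, $\theta^{(m),k+1}:=\theta^{(m),k}$. 3. For $m\in\mathcal{M}^k$, update $p^{(m)}_r:=\sum_{s=1}^{S^{(m)}}\theta^{(m),k+1}_{rs}$, $r=1,\ldots,R$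 (for $m\notin\mathcal{M}^k$, $p^{(m)}$ is unchanged). The algorithm is run indefinitely (no stopping test). *)

theory Defs
  imports "HOL-Analysis.Analysis" "HOL-Probability.Probability"
begin

text \<open>
  The number R of candidate points and the total number T of columns are the cardinalities of
  the index types \<open>'r\<close> and \<open>'t\<close>, so an R x T matrix has type \<open>real ^ 't ^ 'r\<close>, whose norm is the
  Euclidean (Frobenius) one.  The block structure is given by \<open>col\<close>: column s of block m of a
  matrix \<open>\<theta>\<close> is column \<open>col D m s\<close>, where m ranges over \<open>{1..nmeas D}\<close> and s over
  \<open>{1..nsupp D m}\<close>.  Values of the fields outside these ranges are irrelevant.
\<close>

record ('d, 'r, 't) wb_data =
  nmeas :: nat                                         (* M *)
  nsupp :: "nat \<Rightarrow> nat"                         (* S^(m) *)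
  col   :: "nat \<Rightarrow> nat \<Rightarrow> 't"
  wt    :: "nat \<Rightarrow> real"                        (* alpha_m *)
  mass  :: "nat \<Rightarrow> nat \<Rightarrow> real"          (* q^(m)_s *)
  supp  :: "nat \<Rightarrow> nat \<Rightarrow> real ^ 'd"     (* zeta^(m)_s *)
  cand  :: "'r \<Rightarrow> real ^ 'd"                    (* xi_r *)

definition positions :: "('d::finite, 'r::finite, 't::finite) wb_data \<Rightarrow> (nat \<times> nat) set" where
  "positions D = (SIGMA m:{1..nmeas D}. {1..nsupp D m})"

definition valid_data :: "('d::finite, 'r::finite, 't::finite) wb_data \<Rightarrow> bool" where
  "valid_data D \<longleftrightarrow>
     bij_betw (\<lambda>(m, s). col D m s) (positions D) UNIV \<and>
     (\<forall>m\<in>{1..nmeas D}. 1 \<le> nsupp D m) \<and>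
     (\<forall>m\<in>{1..nmeas D}. 0 \<le> wt D m) \<and> (\<Sum>m=1..nmeas D. wt D m) = 1 \<and>
     (\<forall>m\<in>{1..nmeas D}. \<forall>s\<in>{1..nsupp D m}. 0 \<le> mass D m s)"

definition position :: "('d::finite, 'r::finite, 't::finite) wb_data \<Rightarrow> 't \<Rightarrow> nat \<times> nat" where
  "position D = the_inv_into (positions D) (\<lambda>(m, s). col D m s)"

definition simplex_of :: "real \<Rightarrow> (real ^ 'r::finite) set" where
  "simplex_of \<tau> = {u. (\<forall>i. 0 \<le> u $ i) \<and> (\<Sum>i\<in>UNIV. u $ i) = \<tau>}"

definition has_totals :: "('d::finite, 'r::finite, 't::finite) wb_data \<Rightarrow> real \<Rightarrow> bool" where
  "has_totals D \<tau> \<longleftrightarrow> (\<forall>m\<in>{1..nmeas D}. (\<Sum>s=1..nsupp D m. mass D m s) = \<tau>)"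

definition balanced :: "('d::finite, 'r::finite, 't::finite) wb_data \<Rightarrow> bool" where
  "balanced D \<longleftrightarrow> (\<exists>\<tau>. has_totals D \<tau>)"

definition cost :: "('d::finite, 'r::finite, 't::finite) wb_data \<Rightarrow> nat \<Rightarrow> 'r \<Rightarrow> nat \<Rightarrow> real" where
  "cost D m r s = wt D m * (norm (cand D r - supp D m s))\<^sup>2"

definition total_cost :: "('d::finite, 'r::finite, 't::finite) wb_data \<Rightarrow> real ^ 't ^ 'r \<Rightarrow> real" where
  "total_cost D \<pi> =
     (\<Sum>m=1..nmeas D. \<Sum>r\<in>UNIV. \<Sum>s=1..nsupp D m. cost D m r s * \<pi> $ r $ col D m s)"

definition marg ::
  "('d::finite, 'r::finite, 't::finite) wb_data \<Rightarrow> real ^ 't ^ 'r \<Rightarrow> nat \<Rightarrow> real ^ 'r" where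
  "marg D \<theta> m = (\<chi> r. \<Sum>s=1..nsupp D m. \<theta> $ r $ col D m s)"

text \<open>
  \<open>\<Pi>^(m)\<close> constrains block m only; \<open>plans D m\<close> is the set of full matrices whose m-th block lies in it.
\<close>

definition plans ::
  "('d::finite, 'r::finite, 't::finite) wb_data \<Rightarrow> nat \<Rightarrow> (real ^ 't ^ 'r) set" where
  "plans D m = {\<pi>. \<forall>s\<in>{1..nsupp D m}.
     (\<forall>r. 0 \<le> \<pi> $ r $ col D m s) \<and> (\<Sum>r\<in>UNIV. \<pi> $ r $ col D m s) = mass D m s}"

definition bal_space :: "('d::finite, 'r::finite, 't::finite) wb_data \<Rightarrow> (real ^ 't ^ 'r) set" where
  "bal_space D = {\<pi>. \<forall>r. \<forall>m\<in>{1..<nmeas D}.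
     (\<Sum>s=1..nsupp D m. \<pi> $ r $ col D m s) =
     (\<Sum>s=1..nsupp D (m + 1). \<pi> $ r $ col D (m + 1) s)}"

definition lp_feasible ::
  "('d::finite, 'r::finite, 't::finite) wb_data \<Rightarrow> real \<Rightarrow> real ^ 'r \<Rightarrow> real ^ 't ^ 'r \<Rightarrow> bool" where
  "lp_feasible D \<tau> p \<pi> \<longleftrightarrow>
     p \<in> simplex_of \<tau> \<and>
     (\<forall>m\<in>{1..nmeas D}. \<forall>r. \<forall>s\<in>{1..nsupp D m}. 0 \<le> \<pi> $ r $ col D m s) \<and>
     (\<forall>m\<in>{1..nmeas D}. \<forall>s\<in>{1..nsupp D m}. (\<Sum>r\<in>UNIV. \<pi> $ r $ col D m s) = mass D m s) \<and>
     (\<forall>m\<in>{1..nmeas D}. \<forall>r. (\<Sum>s=1..nsupp D m. \<pi> $ r $ col D m s) = p $ r)"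

definition balanced_barycenter ::
  "('d::finite, 'r::finite, 't::finite) wb_data \<Rightarrow> real ^ 'r \<Rightarrow> bool" where
  "balanced_barycenter D p \<longleftrightarrow>
     (\<exists>\<tau>. has_totals D \<tau> \<and>
       (\<exists>\<pi>. lp_feasible D \<tau> p \<pi> \<and>
          (\<forall>p' \<pi>'. lp_feasible D \<tau> p' \<pi>' \<longrightarrow> total_cost D \<pi> \<le> total_cost D \<pi>')))"

definition solves_unbalanced ::
  "('d::finite, 'r::finite, 't::finite) wb_data \<Rightarrow> real \<Rightarrow> real ^ 't ^ 'r \<Rightarrow> bool" where
  "solves_unbalanced D \<gamma> \<pi> \<longleftrightarrow>
     (\<forall>m\<in>{1..nmeas D}. \<pi> \<in> plans D m) \<and>
     (\<forall>\<pi>'. (\<forall>m\<in>{1..nmeas D}. \<pi>' \<in> plans D m) \<longrightarrow>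
        total_cost D \<pi> + \<gamma> * infdist \<pi> (bal_space D)
        \<le> total_cost D \<pi>' + \<gamma> * infdist \<pi>' (bal_space D))"

definition unbalanced_barycenter ::
  "('d::finite, 'r::finite, 't::finite) wb_data \<Rightarrow> real \<Rightarrow> real ^ 'r \<Rightarrow> bool" where
  "unbalanced_barycenter D \<gamma> p \<longleftrightarrow>
     (\<exists>\<pi>. solves_unbalanced D \<gamma> \<pi> \<and>
        (\<forall>m\<in>{1..nmeas D}. p = marg D (closest_point (bal_space D) \<pi>) m))"

text \<open>
  A state of the algorithm consists of the current matrix \<open>\<theta>\<close> and the current vectors
  \<open>pm m\<close> (block marginals).  The parameter \<open>\<gamma>\<close> is extended real, \<open>\<gamma> = \<infinity>\<close> giving step size 1 throughout.
\<close>

definition avg_weight :: "('d::finite, 'r::finite, 't::finite) wb_data \<Rightarrow> nat \<Rightarrow> real" where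
  "avg_weight D m = (1 / real (nsupp D m)) / (\<Sum>j=1..nmeas D. 1 / real (nsupp D j))"

definition avg_marg ::
  "('d::finite, 'r::finite, 't::finite) wb_data \<Rightarrow> (nat \<Rightarrow> real ^ 'r) \<Rightarrow> real ^ 'r" where
  "avg_marg D pm = (\<Sum>m=1..nmeas D. avg_weight D m *\<^sub>R pm m)"

definition marg_dev ::
  "('d::finite, 'r::finite, 't::finite) wb_data \<Rightarrow> (nat \<Rightarrow> real ^ 'r) \<Rightarrow> real" where
  "marg_dev D pm =
     sqrt (\<Sum>m=1..nmeas D. (norm (avg_marg D pm - pm m))\<^sup>2 / real (nsupp D m))"

definition step_size ::
  "('d::finite, 'r::finite, 't::finite) wb_data \<Rightarrow> real \<Rightarrow> ereal \<Rightarrow> (nat \<Rightarrow> real ^ 'r) \<Rightarrow> real" where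
  "step_size D \<rho> \<gamma> pm =
     (if ereal (\<rho> * marg_dev D pm) \<le> \<gamma> then 1
      else real_of_ereal \<gamma> / (\<rho> * marg_dev D pm))"

definition proj_column ::
  "('d::finite, 'r::finite, 't::finite) wb_data \<Rightarrow> real \<Rightarrow> ereal \<Rightarrow>
    real ^ 't ^ 'r \<Rightarrow> (nat \<Rightarrow> real ^ 'r) \<Rightarrow> nat \<Rightarrow> nat \<Rightarrow> real ^ 'r" where
  "proj_column D \<rho> \<gamma> \<theta> pm m s =
     closest_point (simplex_of (mass D m s))
       (\<chi> r. \<theta> $ r $ col D m s
          + 2 * step_size D \<rho> \<gamma> pm * ((avg_marg D pm $ r - pm m $ r) / real (nsupp D m))
          - (1 / \<rho>) * cost D m r s)"

definition next_theta ::
  "('d::finite, 'r::finite, 't::finite) wb_data \<Rightarrow> real \<Rightarrow> ereal \<Rightarrow> nat set \<Rightarrow>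
    real ^ 't ^ 'r \<Rightarrow> (nat \<Rightarrow> real ^ 'r) \<Rightarrow> real ^ 't ^ 'r" where
  "next_theta D \<rho> \<gamma> Mk \<theta> pm =
     (\<chi> r c. case position D c of (m, s) \<Rightarrow>
        if m \<in> Mk
        then proj_column D \<rho> \<gamma> \<theta> pm m s $ r
             - step_size D \<rho> \<gamma> pm * ((avg_marg D pm $ r - pm m $ r) / real (nsupp D m))
        else \<theta> $ r $ c)"

definition mam_step ::
  "('d::finite, 'r::finite, 't::finite) wb_data \<Rightarrow> real \<Rightarrow> ereal \<Rightarrow> nat set \<Rightarrow>
    (real ^ 't ^ 'r) \<times> (nat \<Rightarrow> real ^ 'r) \<Rightarrow> (real ^ 't ^ 'r) \<times> (nat \<Rightarrow> real ^ 'r)" where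
  "mam_step D \<rho> \<gamma> Mk st =
     (let \<theta> = fst st; pm = snd st; \<theta>' = next_theta D \<rho> \<gamma> Mk \<theta> pm
      in (\<theta>', \<lambda>m. if m \<in> Mk then marg D \<theta>' m else pm m))"

primrec mam_state ::
  "('d::finite, 'r::finite, 't::finite) wb_data \<Rightarrow> real \<Rightarrow> ereal \<Rightarrow> (nat \<Rightarrow> nat set) \<Rightarrow>
    real ^ 't ^ 'r \<Rightarrow> nat \<Rightarrow> (real ^ 't ^ 'r) \<times> (nat \<Rightarrow> real ^ 'r)" where
  "mam_state D \<rho> \<gamma> Ms \<theta>0 0 = (\<theta>0, marg D \<theta>0)"
| "mam_state D \<rho> \<gamma> Ms \<theta>0 (Suc k) = mam_step D \<rho> \<gamma> (Ms k) (mam_state D \<rho> \<gamma> Ms \<theta>0 k)"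

definition mam_p ::
  "('d::finite, 'r::finite, 't::finite) wb_data \<Rightarrow> real \<Rightarrow> ereal \<Rightarrow> (nat \<Rightarrow> nat set) \<Rightarrow>
    real ^ 't ^ 'r \<Rightarrow> nat \<Rightarrow> real ^ 'r" where
  "mam_p D \<rho> \<gamma> Ms \<theta>0 k = avg_marg D (snd (mam_state D \<rho> \<gamma> Ms \<theta>0 k))"

end

theory Submission
  imports Defs
begin

text \<open>
  Why the theorem holds.  One full sweep of the algorithm is one Douglas--Rachford step
  \<open>dr \<theta> = plan \<theta> + dual \<theta>\<close> for minimising the transport cost over the plans plus a penalty \<open>g\<close>,
  where \<open>g\<close> is \<open>\<gamma>\<close> times the distance to the balance subspace, or the indicator function of that subspace
  if \<open>\<gamma> = \<infinity>\<close>.  Here \<open>plan \<theta>\<close> is a columnwise projection onto simplices and \<open>dual \<theta>\<close>, the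
  residual of \<open>\<theta>\<close> after a proximal step for \<open>g / \<rho>\<close>, is by Moreau's decomposition the
  projection of \<open>\<theta>\<close> onto the vectors orthogonal to the balance subspace with norm at most \<open>\<gamma> / \<rho>\<close>.  The two projection inequalities say that \<open>dr\<close> is firmly
  nonexpansive (\<open>dr_firm\<close>) and that each of its fixed points yields an optimal plan
  (\<open>fixed_point_optimal\<close>), whose projection to the balance subspace has the averaged marginal \<open>avg \<theta>\<close>.

  A fixed point exists.  If \<open>\<gamma>\<close> is finite, both projections have bounded range, so Brouwer's theorem
  applies (\<open>fixed_point_finite\<close>).  If the measures are balanced and \<open>\<gamma> = \<infinity>\<close>, a plan can be repaired to a
  balanced one at a cost at most proportional to its distance from the balance subspace
  (\<open>exact_penalty\<close>).  Hence for a large finite penalty the optimal plan is balanced already; there the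
  step size is 1, and the fixed point is one for \<open>\<gamma> = \<infinity>\<close> as well (\<open>fixed_point_balanced\<close>).  This replaces
  linear programming duality.

  Updating only a random block \<open>A i\<close>, chosen with probability \<open>\<beta> i\<close>, is a random block-coordinate
  version of \<open>dr\<close>.  If block \<open>i\<close> is weighted by \<open>1 / \<beta> i\<close>, the squared distance \<open>V\<close> to any fixed point
  decreases in expectation by at least \<open>(norm (dr x - x))\<^sup>2\<close> (\<open>block_random_fejer\<close>).  From this
  almost sure convergence follows (\<open>AE_converges\<close>): the iterates come close to the fixed point
  set almost surely, and a nonnegative supermartingale that is small now is unlikely ever to become
  large, so that after such a visit the iterates stay near one fixed point with probability near
  1.  The deterministic algorithm is the case of a single block, drawn with probability 1.
\<close>

section \<open>Finite words of independent draws\<close>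

text \<open>
  The probability that a word of \<open>n\<close> independent letters with weights \<open>\<beta>\<close> satisfies \<open>Q\<close>.  The
  recursion splits off the first letter, so estimates uniform in the starting point of a random
  iteration can be proved by induction on the horizon: the Markov property is built in.
\<close>

primrec word_prob :: "('i \<Rightarrow> real) \<Rightarrow> 'i set \<Rightarrow> nat \<Rightarrow> ('i list \<Rightarrow> bool) \<Rightarrow> real" where
  "word_prob \<beta> J 0 Q = of_bool (Q [])"
| "word_prob \<beta> J (Suc n) Q = (\<Sum>i\<in>J. \<beta> i * word_prob \<beta> J n (\<lambda>w. Q (i # w)))"

lemma word_prob_eq_sum:
  assumes "finite J"
  shows "word_prob \<beta> J n Q =
    (\<Sum>w | set w \<subseteq> J \<and> length w = n. of_bool (Q w) * prod_list (map \<beta> w))"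
proof (induction n arbitrary: Q)
  case 0
  have "{w. set w \<subseteq> J \<and> length w = 0} = {[]}" by auto
  then show ?case by simp
next
  case (Suc n)
  let ?W = "\<lambda>n. {w. set w \<subseteq> J \<and> length w = n}"
  have eq: "?W (Suc n) = (\<lambda>(i, w). i # w) ` (J \<times> ?W n)"
    by (auto simp: image_iff length_Suc_conv)
  have inj: "inj_on (\<lambda>(i, w). i # w) (J \<times> ?W n)" by (auto simp: inj_on_def)
  have "(\<Sum>w\<in>?W (Suc n). of_bool (Q w) * prod_list (map \<beta> w))
      = (\<Sum>(i, w)\<in>J \<times> ?W n. of_bool (Q (i # w)) * (\<beta> i * prod_list (map \<beta> w)))"
    unfolding eq by (subst sum.reindex[OF inj]) (simp add: case_prod_unfold)
  also have "\<dots> = (\<Sum>i\<in>J. \<Sum>w\<in>?W n. of_bool (Q (i # w)) * (\<beta> i * prod_list (map \<beta> w)))"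
    by (rule sum.cartesian_product[symmetric])
  also have "\<dots> = word_prob \<beta> J (Suc n) Q"
    by (simp add: Suc.IH sum_distrib_left algebra_simps)
  finally show ?case by simp
qed

locale prob_weights =
  fixes \<beta> :: "'i \<Rightarrow> real" and J :: "'i set"
  assumes finite_J: "finite J"
    and \<beta>_nonneg: "i \<in> J \<Longrightarrow> 0 \<le> \<beta> i"
    and \<beta>_sum: "(\<Sum>i\<in>J. \<beta> i) = 1"
begin

lemma word_prob_mono:
  assumes "\<And>w. Q w \<Longrightarrow> Q' w"
  shows "word_prob \<beta> J n Q \<le> word_prob \<beta> J n Q'"
  using assms
proof (induction n arbitrary: Q Q')
  case (Suc n)
  show ?case unfolding word_prob.simps
    by (intro sum_mono mult_left_mono Suc.IH \<beta>_nonneg) (use Suc.prems in auto)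
qed auto

lemma word_prob_disj:
  "word_prob \<beta> J n (\<lambda>w. Q w \<or> Q' w) \<le> word_prob \<beta> J n Q + word_prob \<beta> J n Q'"
proof (induction n arbitrary: Q Q')
  case (Suc n)
  have "word_prob \<beta> J (Suc n) (\<lambda>w. Q w \<or> Q' w)
      \<le> (\<Sum>i\<in>J. \<beta> i * (word_prob \<beta> J n (\<lambda>w. Q (i # w)) + word_prob \<beta> J n (\<lambda>w. Q' (i # w))))"
    unfolding word_prob.simps by (intro sum_mono mult_left_mono Suc.IH \<beta>_nonneg)
  then show ?case by (simp add: algebra_simps sum.distrib)
qed auto

lemma word_prob_True: "word_prob \<beta> J n (\<lambda>w. True) = 1"
  by (induction n) (auto simp: \<beta>_sum)

lemma word_prob_False: "word_prob \<beta> J n (\<lambda>w. False) = 0"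
  by (induction n) auto

lemma word_prob_le_1: "word_prob \<beta> J n Q \<le> 1"
  using word_prob_mono[of Q "\<lambda>w. True" n] by (simp add: word_prob_True)

lemma word_prob_nonneg: "0 \<le> word_prob \<beta> J n Q"
  using word_prob_mono[of "\<lambda>w. False" Q n] by (simp add: word_prob_False)

end

section \<open>Random Fejer monotone iterations\<close>

text \<open>
  \<open>V x z\<close> is a Lyapunov function comparable to the squared distance.  The weight-averaged
  descent towards each point of \<open>F\<close> is the supermartingale property; \<open>\<phi>\<close> measures the progress and vanishes
  only on \<open>F\<close>.
\<close>

locale random_fejer = prob_weights \<beta> J for \<beta> :: "'i \<Rightarrow> real" and J +
  fixes T :: "'i \<Rightarrow> 'a::euclidean_space \<Rightarrow> 'a"
    and F :: "'a set" and V :: "'a \<Rightarrow> 'a \<Rightarrow> real" and \<phi> :: "'a \<Rightarrow> real" and c C :: real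
  assumes F_closed: "closed F" and F_nonempty: "F \<noteq> {}"
    and c_pos: "0 < c" and V_lower: "c * (dist x z)\<^sup>2 \<le> V x z"
    and C_pos: "0 < C" and V_upper: "V x z \<le> C * (dist x z)\<^sup>2"
    and descent: "z \<in> F \<Longrightarrow> (\<Sum>i\<in>J. \<beta> i * V (T i x) z) \<le> V x z - \<phi> x"
    and \<phi>_cont: "continuous_on UNIV \<phi>" and \<phi>_nonneg: "0 \<le> \<phi> x"
    and \<phi>_zero: "\<phi> x = 0 \<Longrightarrow> x \<in> F"
begin

lemma V_nonneg: "0 \<le> V x z"
  using V_lower[of x z] c_pos by (meson less_imp_le mult_nonneg_nonneg order_trans zero_le_power2)

text \<open>
  Events for the trajectory from \<open>x\<close> that is driven by the letters of a word, the starting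
  point included.
\<close>

primrec exits :: "'a \<Rightarrow> real \<Rightarrow> 'a \<Rightarrow> 'i list \<Rightarrow> bool" where
  "exits z l x [] = (l \<le> V x z)"
| "exits z l x (i # w) = (l \<le> V x z \<or> exits z l (T i x) w)"

primrec stays :: "'a set \<Rightarrow> 'a \<Rightarrow> 'i list \<Rightarrow> bool" where
  "stays G x [] = (x \<in> G)"
| "stays G x (i # w) = (x \<in> G \<and> stays G (T i x) w)"

text \<open>
  Ville's maximal inequality for the supermartingale \<open>V\<close>.  The recursion over the first letter makes
  it a short induction: either the level is reached at once, or descent preserves the bound.
\<close>

lemma exits_prob:
  assumes z: "z \<in> F" and l: "0 < l"
  shows "word_prob \<beta> J n (exits z l x) \<le> V x z / l"
proof (induction n arbitrary: x)
  case 0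
  show ?case using l V_nonneg[of x z] by (auto simp: field_simps)
next
  case (Suc n)
  show ?case
  proof (cases "l \<le> V x z")
    case True
    then have "1 \<le> V x z / l" using l by simp
    then show ?thesis using word_prob_le_1[of "Suc n" "exits z l x"] by linarith
  next
    case False
    then have "word_prob \<beta> J (Suc n) (exits z l x) = (\<Sum>i\<in>J. \<beta> i * word_prob \<beta> J n (exits z l (T i x)))"
      by simp
    also have "\<dots> \<le> (\<Sum>i\<in>J. \<beta> i * (V (T i x) z / l))"
      by (intro sum_mono mult_left_mono Suc.IH \<beta>_nonneg)
    also have "\<dots> = (\<Sum>i\<in>J. \<beta> i * V (T i x) z) / l" by (simp add: sum_divide_distrib)
    also have "\<dots> \<le> V x z / l"
      using descent[OF z, of x] \<phi>_nonneg[of x] l by (intro divide_right_mono) auto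
    finally show ?thesis .
  qed
qed

text \<open>
  Each step inside \<open>G\<close> costs at least \<open>\<mu>\<close> of the expected value of \<open>V\<close>, and only \<open>V x z\<close> is
  available.
\<close>

lemma stays_prob:
  assumes z: "z \<in> F" and \<mu>: "\<And>x. x \<in> G \<Longrightarrow> \<mu> \<le> \<phi> x" and \<mu>0: "0 \<le> \<mu>"
  shows "real n * \<mu> * word_prob \<beta> J n (stays G x) \<le> V x z"
proof (induction n arbitrary: x)
  case 0
  show ?case using V_nonneg by simp
next
  case (Suc n)
  show ?case
  proof (cases "x \<in> G")
    case False
    then show ?thesis by (simp add: word_prob_False V_nonneg)
  next
    case True
    define p where "p i = word_prob \<beta> J n (stays G (T i x))" for i
    have 1: "(\<Sum>i\<in>J. \<beta> i * p i) \<le> 1"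
    proof -
      have "(\<Sum>i\<in>J. \<beta> i * p i) \<le> (\<Sum>i\<in>J. \<beta> i * 1)"
        by (intro sum_mono mult_left_mono \<beta>_nonneg) (auto simp: p_def word_prob_le_1)
      then show ?thesis by (simp add: \<beta>_sum)
    qed
    have IH: "real n * \<mu> * p i \<le> V (T i x) z" for i unfolding p_def by (rule Suc.IH)
    have "real (Suc n) * \<mu> * word_prob \<beta> J (Suc n) (stays G x)
        = \<mu> * (\<Sum>i\<in>J. \<beta> i * p i) + (\<Sum>i\<in>J. \<beta> i * (real n * \<mu> * p i))"
      using True by (simp add: p_def algebra_simps sum_distrib_left sum.distrib)
    also have "\<dots> \<le> \<mu> * 1 + (\<Sum>i\<in>J. \<beta> i * V (T i x) z)"
      by (intro add_mono mult_left_mono sum_mono \<beta>_nonneg 1 \<mu>0 IH)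
    also have "\<dots> \<le> V x z" using descent[OF z, of x] \<mu>[OF True] by simp
    finally show ?thesis .
  qed
qed

abbreviation near :: "real \<Rightarrow> 'a set" where
  "near \<epsilon> \<equiv> {x. infdist x F < \<epsilon>}"

lemma stays_or_exits:
  "stays (- A) x w \<Longrightarrow> stays (- A \<inter> {y. V y z < l}) x w \<or> exits z l x w"
  by (induction w arbitrary: x) (auto simp: not_le)

text \<open>
  Every neighbourhood of \<open>F\<close> is visited almost surely.  A trajectory that avoids it either
  reaches a high level of \<open>V\<close>, which is unlikely, or stays in a compact set on which \<open>\<phi>\<close> is
  bounded away from 0.
\<close>

lemma avoids_prob:
  assumes \<epsilon>: "0 < \<epsilon>" and \<delta>: "0 < \<delta>"
  shows "\<exists>N. \<forall>n\<ge>N. word_prob \<beta> J n (stays (- near \<epsilon>) x) \<le> \<delta>"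
proof -
  obtain z where z: "z \<in> F" using F_nonempty by auto
  \<comment> \<open>This level makes the bound \<open>V x z / l\<close> on the exit probability at most \<open>\<delta> / 2\<close>.\<close>
  define l where "l = 2 * (V x z + 1) / \<delta>"
  have l: "0 < l" using \<delta> V_nonneg[of x z] by (simp add: l_def)
  define K where "K = {y. \<epsilon> \<le> infdist y F} \<inter> cball z (sqrt (l / c))"
  define G where "G = - near \<epsilon> \<inter> {y. V y z < l}"
  have GK: "G \<subseteq> K"
  proof
    fix y assume "y \<in> G"
    then have "\<epsilon> \<le> infdist y F" "c * (dist y z)\<^sup>2 \<le> l"
      using V_lower[of y z] by (auto simp: G_def)
    then show "y \<in> K" using c_pos
      by (auto simp: K_def field_simps real_le_rsqrt dist_commute)
  qed
  have "compact K" unfolding K_def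
    by (intro closed_Int_compact closed_Collect_le continuous_intros compact_cball)
  have "\<exists>\<mu>>0. \<forall>y\<in>K. \<mu> \<le> \<phi> y"
  proof (cases "K = {}")
    case True
    then show ?thesis by (auto intro: exI[of _ 1])
  next
    case False
    obtain y0 where y0: "y0 \<in> K" "\<forall>y\<in>K. \<phi> y0 \<le> \<phi> y"
      using continuous_attains_inf[OF \<open>compact K\<close> False continuous_on_subset[OF \<phi>_cont]] by auto
    have "\<phi> y0 \<noteq> 0" using y0(1) \<phi>_zero[of y0] \<epsilon> by (auto simp: K_def)
    with \<phi>_nonneg[of y0] y0(2) show ?thesis by (intro exI[of _ "\<phi> y0"]) auto
  qed
  then obtain \<mu> where \<mu>: "0 < \<mu>" "\<And>y. y \<in> G \<Longrightarrow> \<mu> \<le> \<phi> y" using GK by auto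
  define N where "N = Suc (nat \<lceil>2 * V x z / (\<mu> * \<delta>)\<rceil>)"
  have "word_prob \<beta> J n (stays (- near \<epsilon>) x) \<le> \<delta>" if n: "N \<le> n" for n
  proof -
    have n0: "0 < real n" using n by (simp add: N_def)
    have nN: "2 * V x z / (\<mu> * \<delta>) \<le> real n" using n unfolding N_def by linarith
    have "word_prob \<beta> J n (stays G x) \<le> V x z / (real n * \<mu>)"
      using stays_prob[where G = G and n = n and x = x, OF z \<mu>(2)] \<mu>(1) n0 by (simp add: field_simps)
    also have "\<dots> \<le> \<delta> / 2" using nN \<mu>(1) n0 \<delta> by (simp add: field_simps)
    finally have 1: "word_prob \<beta> J n (stays G x) \<le> \<delta> / 2" .
    have 2: "word_prob \<beta> J n (exits z l x) \<le> \<delta> / 2"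
    proof -
      have "\<delta> * l = 2 * (V x z + 1)" using \<delta> by (simp add: l_def)
      then have "V x z / l \<le> \<delta> / 2" using l by (simp add: field_simps)
      with exits_prob[OF z l, of n x] show ?thesis by linarith
    qed
    have "word_prob \<beta> J n (stays (- near \<epsilon>) x) \<le> word_prob \<beta> J n (\<lambda>w. stays G x w \<or> exits z l x w)"
      unfolding G_def by (intro word_prob_mono stays_or_exits)
    also have "\<dots> \<le> \<delta>" using word_prob_disj[of n "stays G x" "exits z l x"] 1 2 by linarith
    finally show ?thesis .
  qed
  then show ?thesis by blast
qed

text \<open>
  Either the trajectory has not come near \<open>F\<close> yet, or at or after its first visit it has left the \<open>V\<close>-ball
  of level \<open>l\<close> around the point of \<open>F\<close> closest to the place of that visit.  Fixing the first visit makes the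
  centre independent of the horizon.
\<close>

primrec unsettled :: "real \<Rightarrow> real \<Rightarrow> 'a \<Rightarrow> 'i list \<Rightarrow> bool" where
  "unsettled \<epsilon> l x [] = (x \<in> near \<epsilon> \<longrightarrow> exits (closest_point F x) l x [])"
| "unsettled \<epsilon> l x (i # w) =
    (if x \<in> near \<epsilon> then exits (closest_point F x) l x (i # w) else unsettled \<epsilon> l (T i x) w)"

text \<open>
  At a visit the centre is within \<open>\<epsilon>\<close>, so \<open>V\<close> starts at most at \<open>C * \<epsilon>\<^sup>2\<close>.
\<close>

lemma exits_closest_prob:
  assumes x: "x \<in> near \<epsilon>" and l: "0 < l"
  shows "word_prob \<beta> J n (exits (closest_point F x) l x) \<le> C * \<epsilon>\<^sup>2 / l"
proof -
  have mem: "closest_point F x \<in> F" by (rule closest_point_in_set[OF F_closed F_nonempty])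
  have d: "dist x (closest_point F x) = infdist x F"
    using setdist_closest_point[OF F_closed F_nonempty, of x]
    by (simp add: infdist_eq_setdist dist_commute)
  have "V x (closest_point F x) \<le> C * (infdist x F)\<^sup>2" using V_upper[of x "closest_point F x"] d by simp
  also have "\<dots> \<le> C * \<epsilon>\<^sup>2" using assms C_pos by (intro mult_left_mono power_mono) (auto simp: infdist_nonneg)
  finally have "V x (closest_point F x) / l \<le> C * \<epsilon>\<^sup>2 / l" using l by (intro divide_right_mono) auto
  with exits_prob[OF mem l, of n x] show ?thesis by linarith
qed

text \<open>
  The strong Markov property at the first visit, again hidden in the recursion.
\<close>

lemma unsettled_prob:
  assumes l: "0 < l"
  shows "word_prob \<beta> J n (unsettled \<epsilon> l x) \<le> word_prob \<beta> J n (stays (- near \<epsilon>) x) + C * \<epsilon>\<^sup>2 / l"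
proof (induction n arbitrary: x)
  case 0
  have nn: "0 \<le> C * \<epsilon>\<^sup>2 / l" using C_pos l by simp
  show ?case
  proof (cases "x \<in> near \<epsilon>")
    case True
    then show ?thesis using exits_closest_prob[OF True l, of 0] by simp
  qed (use nn in auto)
next
  case (Suc n)
  show ?case
  proof (cases "x \<in> near \<epsilon>")
    case True
    then have "word_prob \<beta> J (Suc n) (unsettled \<epsilon> l x) = word_prob \<beta> J (Suc n) (exits (closest_point F x) l x)"
      by simp
    with exits_closest_prob[OF True l, of "Suc n"] word_prob_nonneg[of "Suc n" "stays (- near \<epsilon>) x"]
    show ?thesis by linarith
  next
    case False
    then have "word_prob \<beta> J (Suc n) (unsettled \<epsilon> l x) = (\<Sum>i\<in>J. \<beta> i * word_prob \<beta> J n (unsettled \<epsilon> l (T i x)))"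
      by simp
    also have "\<dots> \<le> (\<Sum>i\<in>J. \<beta> i * (word_prob \<beta> J n (stays (- near \<epsilon>) (T i x)) + C * \<epsilon>\<^sup>2 / l))"
      by (intro sum_mono mult_left_mono Suc.IH \<beta>_nonneg)
    also have "\<dots> = word_prob \<beta> J (Suc n) (stays (- near \<epsilon>) x) + (\<Sum>i\<in>J. \<beta> i) * (C * \<epsilon>\<^sup>2 / l)"
      using False by (simp add: distrib_left sum.distrib sum_distrib_right sum_divide_distrib)
    finally show ?thesis by (simp add: \<beta>_sum)
  qed
qed

lemma not_exitsD: "\<not> exits z l x w \<Longrightarrow> k \<le> length w \<Longrightarrow> V (fold T (take k w) x) z < l"
  by (induction w arbitrary: x k) (auto simp: take_Cons' not_le)

lemma not_unsettledD:
  assumes "\<not> unsettled \<epsilon> l x w"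
  shows "\<exists>n\<le>length w. (\<forall>m<n. fold T (take m w) x \<notin> near \<epsilon>) \<and> fold T (take n w) x \<in> near \<epsilon> \<and>
    (\<forall>k. n \<le> k \<and> k \<le> length w \<longrightarrow>
       V (fold T (take k w) x) (closest_point F (fold T (take n w) x)) < l)"
  using assms
proof (induction w arbitrary: x)
  case Nil
  then show ?case by (auto simp: not_le)
next
  case (Cons i w)
  show ?case
  proof (cases "x \<in> near \<epsilon>")
    case True
    then have "\<not> exits (closest_point F x) l x (i # w)" using Cons.prems by simp
    from not_exitsD[OF this] True show ?thesis by (intro exI[of _ 0]) auto
  next
    case False
    then have "\<not> unsettled \<epsilon> l (T i x) w" using Cons.prems by simp
    from Cons.IH[OF this] obtain n where n: "n \<le> length w"
      "\<forall>m<n. fold T (take m w) (T i x) \<notin> near \<epsilon>" "fold T (take n w) (T i x) \<in> near \<epsilon>"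
      "\<forall>k. n \<le> k \<and> k \<le> length w \<longrightarrow>
       V (fold T (take k w) (T i x)) (closest_point F (fold T (take n w) (T i x))) < l"
      by blast
    show ?thesis
    proof (intro exI[of _ "Suc n"] conjI allI impI)
      fix m assume "m < Suc n"
      then show "fold T (take m (i # w)) x \<notin> near \<epsilon>" using n(2) False by (cases m) auto
    next
      fix k assume "Suc n \<le> k \<and> k \<le> length (i # w)"
      then show "V (fold T (take k (i # w)) x) (closest_point F (fold T (take (Suc n) (i # w)) x)) < l"
        using n(4) by (cases k) auto
    qed (use n in auto)
  qed
qed

text \<open>
  For a fixed sequence of draws the first visit does not depend on the horizon \<open>N\<close>, so being settled for
  arbitrarily long horizons means being settled for ever.
\<close>

lemma settled_frequently:
  fixes i :: "nat \<Rightarrow> 'i"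
  assumes "\<exists>\<^sub>\<infinity>N. \<not> unsettled \<epsilon> l x (map i [0..<N])"
  shows "\<exists>n. \<exists>z\<in>F. \<forall>k\<ge>n. V (fold T (map i [0..<k]) x) z < l"
proof -
  define X where "X k = fold T (map i [0..<k]) x" for k
  have tk: "fold T (take k (map i [0..<N])) x = X k" if "k \<le> N" for k N
    using that by (simp add: X_def take_map)
  have D: "\<exists>n\<le>N. (\<forall>m<n. X m \<notin> near \<epsilon>) \<and> X n \<in> near \<epsilon> \<and>
      (\<forall>k. n \<le> k \<and> k \<le> N \<longrightarrow> V (X k) (closest_point F (X n)) < l)"
    if uns: "\<not> unsettled \<epsilon> l x (map i [0..<N])" for N
  proof -
    from not_unsettledD[OF uns] obtain n where n: "n \<le> N"
      "\<forall>m<n. fold T (take m (map i [0..<N])) x \<notin> near \<epsilon>" "fold T (take n (map i [0..<N])) x \<in> near \<epsilon>"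
      "\<forall>k. n \<le> k \<and> k \<le> N \<longrightarrow> V (fold T (take k (map i [0..<N])) x)
         (closest_point F (fold T (take n (map i [0..<N])) x)) < l"
      by auto
    then show ?thesis using tk by (intro exI[of _ n]) auto
  qed
  obtain N0 where "\<not> unsettled \<epsilon> l x (map i [0..<N0])"
    using assms by (auto simp: INFM_nat)
  from D[OF this] obtain n where n: "\<forall>m<n. X m \<notin> near \<epsilon>" "X n \<in> near \<epsilon>" by blast
  have "V (X k) (closest_point F (X n)) < l" if k: "n \<le> k" for k
  proof -
    obtain N where N: "k < N" "\<not> unsettled \<epsilon> l x (map i [0..<N])" using assms by (auto simp: INFM_nat)
    from D[OF N(2)] obtain n' where n': "\<forall>m<n'. X m \<notin> near \<epsilon>" "X n' \<in> near \<epsilon>"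
      "\<forall>k. n' \<le> k \<and> k \<le> N \<longrightarrow> V (X k) (closest_point F (X n')) < l" by blast
    have "n' = n" using n n'(1,2) by (meson linorder_neqE_nat)
    then show ?thesis using n'(3) N(1) k by auto
  qed
  then show ?thesis unfolding X_def[symmetric]
    using closest_point_in_set[OF F_closed F_nonempty] by blast
qed

end

section \<open>Almost sure convergence\<close>

text \<open>
  Independence enters through cylinder probabilities only, which also covers a degenerate
  single-letter alphabet.
\<close>

locale iid_draws = prob_weights \<beta> J + prob_space P
  for \<beta> :: "'i::countable \<Rightarrow> real" and J and P :: "'w measure" +
  fixes I :: "nat \<Rightarrow> 'w \<Rightarrow> 'i"
  assumes I_meas [measurable]: "I k \<in> measurable P (count_space UNIV)"
    and cylinder: "set w \<subseteq> J \<Longrightarrow>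
      prob {\<omega> \<in> space P. map (\<lambda>k. I k \<omega>) [0..<length w] = w} = prod_list (map \<beta> w)"
begin

lemma prefix_measurable [measurable]:
  "(\<lambda>\<omega>. map (\<lambda>k. I k \<omega>) [0..<n]) \<in> measurable P (count_space UNIV)"
proof (induction n)
  case (Suc n)
  note Suc[measurable]
  have "(\<lambda>\<omega>. map (\<lambda>k. I k \<omega>) [0..<n] @ [I n \<omega>]) \<in> measurable P (count_space UNIV)"
    by measurable
  then show ?case by simp
qed simp

text \<open>
  Words with a letter outside \<open>J\<close> have probability 0 because those over \<open>J\<close> already have total
  probability 1.
\<close>

lemma prob_prefix_le:
  "prob {\<omega> \<in> space P. Q (map (\<lambda>k. I k \<omega>) [0..<n])} \<le> word_prob \<beta> J n Q"
proof -
  define W where "W = {w. set w \<subseteq> J \<and> length w = n}"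
  define pre where "pre \<omega> = map (\<lambda>k. I k \<omega>) [0..<n]" for \<omega>
  have [measurable]: "pre \<in> measurable P (count_space UNIV)" unfolding pre_def by measurable
  have finW: "finite W" unfolding W_def by (rule finite_lists_length_eq[OF finite_J])
  have law: "prob {\<omega> \<in> space P. pre \<omega> \<in> W \<and> R (pre \<omega>)} = word_prob \<beta> J n R" for R
  proof -
    have "{\<omega> \<in> space P. pre \<omega> \<in> W \<and> R (pre \<omega>)} = (\<Union>w\<in>{w\<in>W. R w}. {\<omega> \<in> space P. pre \<omega> = w})"
      by auto
    also have "prob \<dots> = (\<Sum>w\<in>{w\<in>W. R w}. prob {\<omega> \<in> space P. pre \<omega> = w})"
      by (rule finite_measure_finite_Union) (auto simp: finW disjoint_family_on_def)
    also have "\<dots> = (\<Sum>w\<in>{w\<in>W. R w}. prod_list (map \<beta> w))"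
      by (intro sum.cong refl) (auto simp: W_def pre_def cylinder)
    also have "\<dots> = (\<Sum>w\<in>W. of_bool (R w) * prod_list (map \<beta> w))"
      by (rule sum.mono_neutral_cong_left) (auto simp: finW)
    finally show ?thesis by (simp add: word_prob_eq_sum[OF finite_J] W_def)
  qed
  have "prob {\<omega> \<in> space P. pre \<omega> \<in> W} = 1"
    using law[of "\<lambda>w. True"] by (simp add: word_prob_True)
  then have "AE \<omega> in P. pre \<omega> \<in> W"
    by (subst prob_Collect_eq_1[symmetric]) auto
  then have "prob {\<omega> \<in> space P. Q (pre \<omega>)} = prob {\<omega> \<in> space P. pre \<omega> \<in> W \<and> Q (pre \<omega>)}"
    by (intro finite_measure_eq_AE) auto
  then show ?thesis using law[of Q] by (simp add: pre_def)
qed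

end

locale random_fejer_process = random_fejer \<beta> J T F V \<phi> c C + iid_draws \<beta> J P I
  for \<beta> :: "'i::countable \<Rightarrow> real" and J T and F :: "'a::euclidean_space set"
    and V \<phi> c C and P :: "'w measure" and I
begin

text \<open>
  The exceptional event lies in \<open>liminf\<close> of the unsettled events, for each \<open>\<epsilon>\<close>, and so has
  probability at most \<open>C * \<epsilon>\<^sup>2 / l\<close>.
\<close>

lemma AE_settles:
  assumes l: "0 < l"
  shows "AE \<omega> in P. \<exists>n. \<exists>z\<in>F. \<forall>k\<ge>n. V (fold T (map (\<lambda>k. I k \<omega>) [0..<k]) x) z < l"
proof -
  define U where "U \<epsilon> N = {\<omega> \<in> space P. unsettled \<epsilon> l x (map (\<lambda>k. I k \<omega>) [0..<N])}" for \<epsilon> N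
  define B where "B = {\<omega> \<in> space P. \<not> (\<exists>n. \<exists>z\<in>F. \<forall>k\<ge>n. V (fold T (map (\<lambda>k. I k \<omega>) [0..<k]) x) z < l)}"
  define L where "L \<epsilon> m = (\<Inter>N\<in>{m..}. U \<epsilon> N)" for \<epsilon> m
  have U_meas [measurable]: "U \<epsilon> N \<in> events" for \<epsilon> N unfolding U_def by measurable
  have L_meas [measurable]: "L \<epsilon> m \<in> events" for \<epsilon> m unfolding L_def by measurable
  have BL: "B \<subseteq> (\<Union>m. L \<epsilon> m)" for \<epsilon>
  proof
    fix \<omega> assume \<omega>: "\<omega> \<in> B"
    then have "\<not> (\<exists>\<^sub>\<infinity>N. \<not> unsettled \<epsilon> l x (map (\<lambda>k. I k \<omega>) [0..<N]))"
      using settled_frequently[of \<epsilon> l x "\<lambda>k. I k \<omega>"] unfolding B_def by blast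
    then obtain m where "\<forall>N\<ge>m. unsettled \<epsilon> l x (map (\<lambda>k. I k \<omega>) [0..<N])"
      unfolding not_INFM MOST_nat_le by blast
    then show "\<omega> \<in> (\<Union>m. L \<epsilon> m)" using \<omega> by (auto simp: L_def U_def B_def)
  qed
  have L_prob: "prob (L \<epsilon> m) \<le> C * \<epsilon>\<^sup>2 / l" if \<epsilon>: "0 < \<epsilon>" for \<epsilon> m
  proof (rule field_le_epsilon)
    fix \<delta> :: real assume "0 < \<delta>"
    from avoids_prob[OF \<epsilon> this, of x] obtain N
      where N: "\<And>n. N \<le> n \<Longrightarrow> word_prob \<beta> J n (stays (- near \<epsilon>) x) \<le> \<delta>" by blast
    define n where "n = max N m"
    have "prob (L \<epsilon> m) \<le> prob (U \<epsilon> n)"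
      by (rule finite_measure_mono) (auto simp: L_def n_def)
    also have "\<dots> \<le> word_prob \<beta> J n (unsettled \<epsilon> l x)" unfolding U_def by (rule prob_prefix_le)
    also have "\<dots> \<le> C * \<epsilon>\<^sup>2 / l + \<delta>"
      using unsettled_prob[OF l, of n \<epsilon> x] N[of n] by (auto simp: n_def)
    finally show "prob (L \<epsilon> m) \<le> C * \<epsilon>\<^sup>2 / l + \<delta>" .
  qed
  have UL_prob: "prob (\<Union>m. L \<epsilon> m) \<le> C * \<epsilon>\<^sup>2 / l" if \<epsilon>: "0 < \<epsilon>" for \<epsilon>
  proof -
    have "incseq (L \<epsilon>)" by (auto simp: incseq_def L_def)
    then have "(\<lambda>m. prob (L \<epsilon> m)) \<longlonglongrightarrow> prob (\<Union>m. L \<epsilon> m)"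
      by (intro finite_Lim_measure_incseq) auto
    then show ?thesis by (rule LIMSEQ_le_const2) (use L_prob[OF \<epsilon>] in auto)
  qed
  define B' where "B' = (\<Inter>j::nat. \<Union>m. L (1 / real (Suc j)) m)"
  have [measurable]: "B' \<in> events" unfolding B'_def by measurable
  have "prob B' \<le> C * (1 / real (Suc j))\<^sup>2 / l" for j
  proof -
    have "prob B' \<le> prob (\<Union>m. L (1 / real (Suc j)) m)"
      by (rule finite_measure_mono) (auto simp: B'_def)
    with UL_prob[of "1 / real (Suc j)"] show ?thesis by simp
  qed
  moreover have "(\<lambda>j. C * (1 / real (Suc j))\<^sup>2 / l) \<longlonglongrightarrow> C * 0\<^sup>2 / l"
    by (intro tendsto_intros LIMSEQ_Suc lim_1_over_n) (use l in auto)
  ultimately have "prob B' \<le> 0" by (intro LIMSEQ_le_const) auto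
  then have "prob B' = 0" by (simp add: measure_le_0_iff)
  then have "B' \<in> null_sets P" by (simp add: emeasure_eq_measure null_setsI)
  moreover have "B \<subseteq> B'" using BL by (auto simp: B'_def)
  ultimately show ?thesis by (auto intro!: AE_I' simp: B_def)
qed

text \<open>
  Almost surely the iterates settle at every level \<open>1 / Suc j\<close>, around some point of \<open>F\<close>.  So they form a
  Cauchy sequence, and its limit is also the limit of the centres, hence in the closed set \<open>F\<close>.
\<close>

theorem AE_converges:
  "AE \<omega> in P. \<exists>z\<in>F. (\<lambda>k. fold T (map (\<lambda>k. I k \<omega>) [0..<k]) x) \<longlonglongrightarrow> z"
proof -
  have "AE \<omega> in P. \<forall>j::nat. \<exists>n. \<exists>z\<in>F. \<forall>k\<ge>n.
      V (fold T (map (\<lambda>k. I k \<omega>) [0..<k]) x) z < c * (1 / real (Suc j))\<^sup>2"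
    by (subst AE_all_countable) (use c_pos in \<open>auto intro!: AE_settles\<close>)
  then show ?thesis
  proof eventually_elim
    fix \<omega>
    define X where "X k = fold T (map (\<lambda>k. I k \<omega>) [0..<k]) x" for k
    assume "\<forall>j::nat. \<exists>n. \<exists>z\<in>F. \<forall>k\<ge>n. V (fold T (map (\<lambda>k. I k \<omega>) [0..<k]) x) z < c * (1 / real (Suc j))\<^sup>2"
    then obtain n z where nz: "\<And>j. z j \<in> F"
      "\<And>j k. n j \<le> k \<Longrightarrow> V (X k) (z j) < c * (1 / real (Suc j))\<^sup>2"
      unfolding X_def by metis
    have close: "dist (X k) (z j) < 1 / real (Suc j)" if "n j \<le> k" for j k :: nat
    proof -
      have "c * (dist (X k) (z j))\<^sup>2 < c * (1 / real (Suc j))\<^sup>2"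
        using V_lower[of "X k" "z j"] nz(2)[OF that] by linarith
      then have "(dist (X k) (z j))\<^sup>2 < (1 / real (Suc j))\<^sup>2" using c_pos by simp
      then show ?thesis by (rule power2_less_imp_less) simp
    qed
    have "Cauchy X"
    proof (rule metric_CauchyI)
      fix e :: real assume "0 < e"
      then obtain j where j: "1 / real (Suc j) < e / 2" by (meson half_gt_zero nat_approx_posE)
      show "\<exists>M. \<forall>m\<ge>M. \<forall>n\<ge>M. dist (X m) (X n) < e"
      proof (intro exI[of _ "n j"] allI impI)
        fix a b assume "n j \<le> a" "n j \<le> b"
        then show "dist (X a) (X b) < e"
          using close[of j a] close[of j b] j dist_triangle2[of "X a" "X b" "z j"] by linarith
      qed
    qed
    then obtain y where y: "X \<longlonglongrightarrow> y" by (auto simp: Cauchy_convergent_iff convergent_def)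
    have le: "dist y (z j) \<le> 1 / real (Suc j)" for j
    proof (rule LIMSEQ_le_const2)
      show "(\<lambda>k. dist (X k) (z j)) \<longlonglongrightarrow> dist y (z j)" by (intro tendsto_intros y)
      show "\<exists>N. \<forall>k\<ge>N. dist (X k) (z j) \<le> 1 / real (Suc j)" using close less_imp_le by blast
    qed
    have "z \<longlonglongrightarrow> y"
    proof (rule metric_LIMSEQ_I)
      fix e :: real assume "0 < e"
      then obtain j where j: "1 / real (Suc j) < e" by (meson nat_approx_posE)
      show "\<exists>no. \<forall>n\<ge>no. dist (z n) y < e"
      proof (intro exI[of _ j] allI impI)
        fix i assume "j \<le> i"
        then have "1 / real (Suc i) \<le> 1 / real (Suc j)" by (intro divide_left_mono) auto
        then show "dist (z i) y < e" using le[of i] j by (simp add: dist_commute)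
      qed
    qed
    then have "y \<in> F" using F_closed nz(1) closed_sequentially by blast
    then show "\<exists>z\<in>F. (\<lambda>k. fold T (map (\<lambda>k. I k \<omega>) [0..<k]) x) \<longlonglongrightarrow> z"
      using y unfolding X_def by blast
  qed
qed

end

section \<open>Matrices as Euclidean vectors\<close>

lemma inner_matrix: "(x :: real ^ 't::finite ^ 'r::finite) \<bullet> y = (\<Sum>c\<in>UNIV. \<Sum>r\<in>UNIV. x $ r $ c * y $ r $ c)"
  unfolding inner_vec_def by (simp add: sum.swap[of "\<lambda>r c. x $ r $ c * y $ r $ c"])

lemma norm_matrix_sq: "(norm (x :: real ^ 't::finite ^ 'r::finite))\<^sup>2 = (\<Sum>c\<in>UNIV. \<Sum>r\<in>UNIV. (x $ r $ c)\<^sup>2)"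
  unfolding power2_norm_eq_inner inner_matrix by (simp add: power2_eq_square)

lemma dist_sq_eq: "(dist (x :: real ^ 't::finite ^ 'r::finite) z)\<^sup>2 = (\<Sum>c\<in>UNIV. \<Sum>r\<in>UNIV. (x $ r $ c - z $ r $ c)\<^sup>2)"
  by (simp add: dist_norm norm_matrix_sq)

lemma entry_le_norm: "\<bar>(x :: real ^ 't::finite ^ 'r::finite) $ r $ c\<bar> \<le> norm x"
proof -
  have "norm (x $ r) \<le> norm x" by (rule Finite_Cartesian_Product.norm_nth_le)
  then show ?thesis using component_le_norm_cart[of "x $ r" c] by linarith
qed

lemma norm_matrix_le_sum: "norm (x :: real ^ 't::finite ^ 'r::finite) \<le> (\<Sum>c\<in>UNIV. \<Sum>r\<in>UNIV. \<bar>x $ r $ c\<bar>)"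
proof -
  have "norm x \<le> (\<Sum>r\<in>UNIV. norm (x $ r))" unfolding norm_vec_def by (rule L2_set_le_sum) auto
  also have "\<dots> \<le> (\<Sum>r\<in>UNIV. \<Sum>c\<in>UNIV. \<bar>x $ r $ c\<bar>)" by (intro sum_mono norm_le_l1_cart)
  finally show ?thesis by (subst sum.swap)
qed

section \<open>Simplices and block weights\<close>

lemma simplex_of_convex: "convex (simplex_of \<tau>)"
proof (rule convexI)
  fix x y :: "real ^ 'a" and u v :: real
  assume *: "x \<in> simplex_of \<tau>" "y \<in> simplex_of \<tau>" "0 \<le> u" "0 \<le> v" "u + v = 1"
  then have "(\<Sum>i\<in>UNIV. u * x $ i + v * y $ i) = u * \<tau> + v * \<tau>"
    by (simp add: simplex_of_def sum.distrib sum_distrib_left[symmetric])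
  also have "\<dots> = \<tau>" using * by (simp add: distrib_right[symmetric])
  finally show "u *\<^sub>R x + v *\<^sub>R y \<in> simplex_of \<tau>" using * by (simp add: simplex_of_def)
qed

lemma simplex_of_closed: "closed (simplex_of \<tau>)"
proof -
  have eq: "simplex_of \<tau> = (\<Inter>i. {u. 0 \<le> u $ i}) \<inter> {u. (\<Sum>i\<in>UNIV. u $ i) = \<tau>}"
    by (auto simp: simplex_of_def)
  show ?thesis
    unfolding eq by (intro closed_Int closed_INT ballI closed_Collect_le closed_Collect_eq continuous_intros)
qed

lemma simplex_of_nonempty: "0 \<le> \<tau> \<Longrightarrow> simplex_of \<tau> \<noteq> {}"
proof -
  assume "0 \<le> \<tau>"
  then have "axis undefined \<tau> \<in> simplex_of \<tau>"
    by (auto simp: simplex_of_def axis_def if_distrib sum.delta cong: if_cong)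
  then show ?thesis by auto
qed

definition weighted_sq :: "('t::finite \<Rightarrow> real) \<Rightarrow> real ^ 't ^ 'r::finite \<Rightarrow> real ^ 't ^ 'r \<Rightarrow> real" where
  "weighted_sq w x z = (\<Sum>c\<in>UNIV. w c * (\<Sum>r\<in>UNIV. (x $ r $ c - z $ r $ c)\<^sup>2))"

section \<open>The balance subspace and its projection\<close>

locale wb =
  fixes D :: "('d::finite, 'r::finite, 't::finite) wb_data"
  assumes valid: "valid_data D"
begin

abbreviation M :: nat where "M \<equiv> nmeas D"
abbreviation S :: "nat \<Rightarrow> nat" where "S \<equiv> nsupp D"

lemma bij_col: "bij_betw (\<lambda>(m, s). col D m s) (positions D) UNIV"
  using valid by (simp add: valid_data_def)

lemma S_pos: "m \<in> {1..M} \<Longrightarrow> 0 < real (S m)"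
proof -
  assume "m \<in> {1..M}"
  then have "1 \<le> S m" using valid unfolding valid_data_def by blast
  then show ?thesis by simp
qed

lemma mass_nonneg: "m \<in> {1..M} \<Longrightarrow> s \<in> {1..S m} \<Longrightarrow> 0 \<le> mass D m s"
  using valid by (auto simp: valid_data_def)

lemma M_pos: "1 \<le> M"
  using valid by (cases M) (auto simp: valid_data_def)

lemma position_col [simp]:
  assumes "m \<in> {1..M}" "s \<in> {1..S m}"
  shows "position D (col D m s) = (m, s)"
proof -
  have "(m, s) \<in> positions D" using assms by (auto simp: positions_def)
  then have "the_inv_into (positions D) (\<lambda>(m, s). col D m s) ((\<lambda>(m, s). col D m s) (m, s)) = (m, s)"
    by (rule the_inv_into_f_f[OF bij_betw_imp_inj_on[OF bij_col]])
  then show ?thesis by (simp add: position_def)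
qed

lemma column_cases:
  obtains m s where "m \<in> {1..M}" "s \<in> {1..S m}" "c = col D m s" "position D c = (m, s)"
proof -
  have "c \<in> (\<lambda>(m, s). col D m s) ` positions D" using bij_col by (simp add: bij_betw_def)
  then obtain m s where "(m, s) \<in> positions D" "c = col D m s" by auto
  then show ?thesis using that by (auto simp: positions_def)
qed

lemma sum_columns: "(\<Sum>c\<in>UNIV. f c) = (\<Sum>m=1..M. \<Sum>s=1..S m. f (col D m s))"
proof -
  have "(\<Sum>c\<in>UNIV. f c) = (\<Sum>x\<in>positions D. f ((\<lambda>(m, s). col D m s) x))"
    by (rule sum.reindex_bij_betw[OF bij_col, symmetric])
  also have "\<dots> = (\<Sum>m=1..M. \<Sum>s=1..S m. f (col D m s))"
    unfolding positions_def by (subst sum.Sigma) (auto simp: case_prod_unfold)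
  finally show ?thesis .
qed

definition block_of :: "'t \<Rightarrow> nat" where "block_of c = fst (position D c)"

lemma block_of_col [simp]: "m \<in> {1..M} \<Longrightarrow> s \<in> {1..S m} \<Longrightarrow> block_of (col D m s) = m"
  by (simp add: block_of_def)

lemma block_of_range: "block_of c \<in> {1..M}"
  by (rule column_cases[of c]) (auto simp: block_of_def)

definition avg :: "real ^ 't ^ 'r \<Rightarrow> real ^ 'r" where
  "avg \<theta> = avg_marg D (marg D \<theta>)"

text \<open>
  Within block \<open>m\<close> the defect of the marginal is spread evenly over its \<open>S m\<close> columns.  This is
  the orthogonal projection because the weights of \<open>avg\<close> are proportional to \<open>1 / S m\<close>
  (\<open>avg_balance\<close>).
\<close>

definition bal_proj :: "real ^ 't ^ 'r \<Rightarrow> real ^ 't ^ 'r" where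
  "bal_proj \<theta> = (\<chi> r c. \<theta> $ r $ c + (avg \<theta> $ r - marg D \<theta> (block_of c) $ r) / real (S (block_of c)))"

lemma inv_S_sum_pos: "0 < (\<Sum>m=1..M. 1 / real (S m))"
  using M_pos S_pos by (intro sum_pos) auto

lemma avg_balance: "(\<Sum>m=1..M. (avg \<theta> $ r - marg D \<theta> m $ r) / real (S m)) = 0"
proof -
  define Z where "Z = (\<Sum>m=1..M. 1 / real (S m))"
  have "Z * avg \<theta> $ r = (\<Sum>m=1..M. Z * (avg_weight D m * marg D \<theta> m $ r))"
    by (simp add: avg_def avg_marg_def sum_distrib_left)
  also have "\<dots> = (\<Sum>m=1..M. marg D \<theta> m $ r / real (S m))"
    using inv_S_sum_pos by (intro sum.cong refl) (simp add: avg_weight_def Z_def)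
  finally have "(\<Sum>m=1..M. avg \<theta> $ r / real (S m)) = (\<Sum>m=1..M. marg D \<theta> m $ r / real (S m))"
    by (simp add: Z_def sum_distrib_right)
  then show ?thesis by (simp add: diff_divide_distrib sum_subtractf)
qed

lemma marg_bal_proj: "m \<in> {1..M} \<Longrightarrow> marg D (bal_proj \<theta>) m = avg \<theta>"
proof (subst vec_eq_iff, intro allI)
  fix r assume m: "m \<in> {1..M}"
  have "marg D (bal_proj \<theta>) m $ r
      = (\<Sum>s=1..S m. \<theta> $ r $ col D m s + (avg \<theta> $ r - marg D \<theta> m $ r) / real (S m))"
    unfolding marg_def bal_proj_def using m by (simp add: marg_def)
  also have "\<dots> = avg \<theta> $ r"
    using S_pos[OF m] by (simp add: sum.distrib marg_def)
  finally show "marg D (bal_proj \<theta>) m $ r = avg \<theta> $ r" .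
qed

lemma bal_space_iff: "\<theta> \<in> bal_space D \<longleftrightarrow> (\<forall>m\<in>{1..M}. marg D \<theta> m = marg D \<theta> 1)"
proof
  assume *: "\<theta> \<in> bal_space D"
  have chain: "m \<le> M \<longrightarrow> marg D \<theta> m = marg D \<theta> 1" if "1 \<le> m" for m
    using that
  proof (induction m rule: nat_induct_at_least)
    case (Suc m)
    have "marg D \<theta> m = marg D \<theta> (m + 1)" if "Suc m \<le> M"
      using * Suc.hyps that by (auto simp: bal_space_def marg_def vec_eq_iff)
    then show ?case using Suc.IH by auto
  qed simp
  show "\<forall>m\<in>{1..M}. marg D \<theta> m = marg D \<theta> 1"
  proof
    fix m assume "m \<in> {1..M}"
    then show "marg D \<theta> m = marg D \<theta> 1" using chain[of m] by auto
  qed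
next
  assume *: "\<forall>m\<in>{1..M}. marg D \<theta> m = marg D \<theta> 1"
  have "marg D \<theta> m = marg D \<theta> (m + 1)" if "m \<in> {1..<M}" for m
    using *[rule_format, of m] *[rule_format, of "m + 1"] that by simp
  then show "\<theta> \<in> bal_space D" by (auto simp: bal_space_def marg_def vec_eq_iff)
qed

lemma bal_proj_in: "bal_proj \<theta> \<in> bal_space D"
  using M_pos by (simp add: bal_space_iff marg_bal_proj)

text \<open>
  The residual is constant along the rows of a block, so it pairs with the marginals of \<open>y\<close> only.  These agree
  across the blocks, and \<open>avg_balance\<close> makes the sum vanish.
\<close>

lemma bal_proj_orthogonal:
  assumes "y \<in> bal_space D"
  shows "(\<theta> - bal_proj \<theta>) \<bullet> y = 0"
proof -
  have "(\<theta> - bal_proj \<theta>) \<bullet> y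
      = (\<Sum>m=1..M. \<Sum>s=1..S m. \<Sum>r\<in>UNIV. - ((avg \<theta> $ r - marg D \<theta> m $ r) / real (S m)) * y $ r $ col D m s)"
    unfolding inner_matrix sum_columns by (intro sum.cong refl) (simp add: bal_proj_def)
  also have "\<dots> = (\<Sum>m=1..M. \<Sum>r\<in>UNIV. \<Sum>s=1..S m. - ((avg \<theta> $ r - marg D \<theta> m $ r) / real (S m)) * y $ r $ col D m s)"
    by (intro sum.cong refl sum.swap)
  also have "\<dots> = (\<Sum>m=1..M. \<Sum>r\<in>UNIV. - ((avg \<theta> $ r - marg D \<theta> m $ r) / real (S m)) * marg D y m $ r)"
    by (simp add: marg_def sum_distrib_left)
  also have "\<dots> = (\<Sum>m=1..M. \<Sum>r\<in>UNIV. - ((avg \<theta> $ r - marg D \<theta> m $ r) / real (S m)) * marg D y 1 $ r)"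
  proof (intro sum.cong refl)
    fix m r assume "m \<in> {1..M}"
    then have "marg D y m = marg D y 1" using assms unfolding bal_space_iff by blast
    then show "- ((avg \<theta> $ r - marg D \<theta> m $ r) / real (S m)) * marg D y m $ r
      = - ((avg \<theta> $ r - marg D \<theta> m $ r) / real (S m)) * marg D y 1 $ r" by simp
  qed
  also have "\<dots> = (\<Sum>r\<in>UNIV. - (\<Sum>m=1..M. (avg \<theta> $ r - marg D \<theta> m $ r) / real (S m)) * marg D y 1 $ r)"
    by (subst sum.swap) (simp add: sum_distrib_right sum_negf)
  also have "\<dots> = 0" by (simp add: avg_balance del: One_nat_def)
  finally show ?thesis .
qed

lemma subspace_bal_space: "subspace (bal_space D)"
  unfolding subspace_def bal_space_def by (auto simp: sum.distrib sum_distrib_left[symmetric])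

lemma bal_proj_closest:
  assumes y: "y \<in> bal_space D"
  shows "norm (\<theta> - bal_proj \<theta>) \<le> norm (\<theta> - y)"
proof -
  have "bal_proj \<theta> - y \<in> bal_space D"
    using subspace_diff[OF subspace_bal_space bal_proj_in y] .
  from bal_proj_orthogonal[OF this, of \<theta>]
  have "(norm (\<theta> - y))\<^sup>2 = (norm (\<theta> - bal_proj \<theta>))\<^sup>2 + (norm (bal_proj \<theta> - y))\<^sup>2"
    using norm_add_Pythagorean[of "\<theta> - bal_proj \<theta>" "bal_proj \<theta> - y"]
    by (simp add: orthogonal_def)
  then have "(norm (\<theta> - bal_proj \<theta>))\<^sup>2 \<le> (norm (\<theta> - y))\<^sup>2" by simp
  then show ?thesis by (simp add: power2_le_iff_abs_le)
qed

lemma bal_proj_unique: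
  assumes "b \<in> bal_space D" "\<And>y. y \<in> bal_space D \<Longrightarrow> n \<bullet> y = 0"
  shows "bal_proj (b + n) = b"
proof -
  define v where "v = bal_proj (b + n) - b"
  have v: "v \<in> bal_space D" unfolding v_def by (rule subspace_diff[OF subspace_bal_space bal_proj_in assms(1)])
  have "(b + n - bal_proj (b + n)) \<bullet> v = 0" by (rule bal_proj_orthogonal[OF v])
  moreover have "n \<bullet> v = 0" by (rule assms(2)[OF v])
  ultimately have "v \<bullet> v = 0" by (simp add: v_def inner_diff_left inner_add_left algebra_simps)
  then show ?thesis by (simp add: v_def)
qed

lemma closest_point_bal_space: "closest_point (bal_space D) \<theta> = bal_proj \<theta>"
  by (rule closest_point_unique[symmetric])
    (auto simp: subspace_imp_convex subspace_bal_space closed_subspace bal_proj_in dist_norm bal_proj_closest)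

lemma infdist_bal_space: "infdist \<theta> (bal_space D) = norm (\<theta> - bal_proj \<theta>)"
proof -
  have "setdist {\<theta>} (bal_space D) = dist \<theta> (closest_point (bal_space D) \<theta>)"
    using setdist_closest_point[of "bal_space D" \<theta>] bal_proj_in closed_subspace[OF subspace_bal_space]
    by blast
  then show ?thesis by (simp add: infdist_eq_setdist closest_point_bal_space dist_norm)
qed

text \<open>
  The step size rule of the algorithm compares \<open>\<rho>\<close> times the distance to the balance subspace with \<open>\<gamma>\<close>.
\<close>

lemma marg_dev_eq: "marg_dev D (marg D \<theta>) = norm (\<theta> - bal_proj \<theta>)"
proof -
  have "(norm (\<theta> - bal_proj \<theta>))\<^sup>2
      = (\<Sum>m=1..M. \<Sum>s=1..S m. \<Sum>r\<in>UNIV. ((avg \<theta> $ r - marg D \<theta> m $ r) / real (S m))\<^sup>2)"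
    unfolding norm_matrix_sq sum_columns by (intro sum.cong refl) (simp add: bal_proj_def)
  also have "\<dots> = (\<Sum>m=1..M. (norm (avg \<theta> - marg D \<theta> m))\<^sup>2 / real (S m))"
  proof (intro sum.cong refl)
    fix m assume m: "m \<in> {1..M}"
    have "(\<Sum>r\<in>UNIV. ((avg \<theta> $ r - marg D \<theta> m $ r) / real (S m))\<^sup>2)
        = (\<Sum>r\<in>UNIV. (avg \<theta> $ r - marg D \<theta> m $ r)\<^sup>2) / (real (S m))\<^sup>2"
      by (simp add: power_divide sum_divide_distrib)
    also have "\<dots> = (norm (avg \<theta> - marg D \<theta> m))\<^sup>2 / (real (S m))\<^sup>2"
      unfolding power2_norm_eq_inner inner_vec_def by (simp add: power2_eq_square)
    finally show "(\<Sum>s=1..S m. \<Sum>r\<in>UNIV. ((avg \<theta> $ r - marg D \<theta> m $ r) / real (S m))\<^sup>2)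
        = (norm (avg \<theta> - marg D \<theta> m))\<^sup>2 / real (S m)"
      using S_pos[OF m] by (simp add: power2_eq_square)
  qed
  also have "\<dots> = (marg_dev D (marg D \<theta>))\<^sup>2"
    unfolding marg_dev_def by (simp add: sum_nonneg avg_def)
  finally have sq: "(marg_dev D (marg D \<theta>))\<^sup>2 = (norm (\<theta> - bal_proj \<theta>))\<^sup>2" ..
  have "0 \<le> marg_dev D (marg D \<theta>)" by (simp add: marg_dev_def sum_nonneg)
  then show ?thesis by (rule power2_eq_imp_eq[OF sq _ norm_ge_zero])
qed

definition all_plans :: "(real ^ 't ^ 'r) set" where
  "all_plans = {\<pi>. \<forall>m\<in>{1..M}. \<pi> \<in> plans D m}"

definition cost_matrix :: "real ^ 't ^ 'r" where
  "cost_matrix = (\<chi> r c. case position D c of (m, s) \<Rightarrow> cost D m r s)"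

lemma total_cost_eq: "total_cost D \<pi> = cost_matrix \<bullet> \<pi>"
proof -
  have "cost_matrix \<bullet> \<pi> = (\<Sum>m=1..M. \<Sum>s=1..S m. \<Sum>r\<in>UNIV. cost D m r s * \<pi> $ r $ col D m s)"
    unfolding inner_matrix sum_columns by (intro sum.cong refl) (simp add: cost_matrix_def)
  also have "\<dots> = total_cost D \<pi>" unfolding total_cost_def by (intro sum.cong refl sum.swap)
  finally show ?thesis by simp
qed

lemma all_plans_norm_le: "\<pi> \<in> all_plans \<Longrightarrow> norm \<pi> \<le> (\<Sum>m=1..M. \<Sum>s=1..S m. mass D m s)"
proof -
  assume "\<pi> \<in> all_plans"
  then have *: "\<And>m s r. m \<in> {1..M} \<Longrightarrow> s \<in> {1..S m} \<Longrightarrow> 0 \<le> \<pi> $ r $ col D m s"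
    "\<And>m s. m \<in> {1..M} \<Longrightarrow> s \<in> {1..S m} \<Longrightarrow> (\<Sum>r\<in>UNIV. \<pi> $ r $ col D m s) = mass D m s"
    by (auto simp: all_plans_def plans_def)
  have "norm \<pi> \<le> (\<Sum>m=1..M. \<Sum>s=1..S m. \<Sum>r\<in>UNIV. \<bar>\<pi> $ r $ col D m s\<bar>)"
    using norm_matrix_le_sum[of \<pi>] unfolding sum_columns .
  also have "\<dots> = (\<Sum>m=1..M. \<Sum>s=1..S m. mass D m s)"
    using * by (intro sum.cong refl) auto
  finally show ?thesis .
qed

end

section \<open>The algorithm as a Douglas--Rachford operator\<close>

text \<open>
  The variational inequalities of a projection at two points, each tested at the other projected
  point, add up to firm nonexpansiveness.
\<close>

lemma firm_of_variational:
  fixes x :: "'a::real_inner"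
  assumes "(x - u) \<bullet> (w - u) \<le> 0" "(z - w) \<bullet> (u - w) \<le> 0"
  shows "0 \<le> (u - w) \<bullet> ((x - z) - (u - w))"
  using assms by (simp add: algebra_simps inner_commute)

locale mam = wb D for D :: "('d::finite, 'r::finite, 't::finite) wb_data" +
  fixes \<rho> :: real and \<gamma> :: ereal
  assumes \<rho>_pos: "0 < \<rho>" and \<gamma>_pos: "0 < \<gamma>"
begin

definition step :: "real ^ 't ^ 'r \<Rightarrow> real" where
  "step \<theta> = step_size D \<rho> \<gamma> (marg D \<theta>)"

text \<open>
  The residual of a proximal step for \<open>g / \<rho>\<close>, where \<open>g\<close> is the penalty on the distance to the balance
  subspace: \<open>\<rho> *\<^sub>R dual \<theta>\<close> is a subgradient of \<open>g\<close> at \<open>\<theta> - dual \<theta>\<close>.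
\<close>

definition dual :: "real ^ 't ^ 'r \<Rightarrow> real ^ 't ^ 'r" where
  "dual \<theta> = step \<theta> *\<^sub>R (\<theta> - bal_proj \<theta>)"

definition plan :: "real ^ 't ^ 'r \<Rightarrow> real ^ 't ^ 'r" where
  "plan \<theta> = (\<chi> r c. case position D c of (m, s) \<Rightarrow> proj_column D \<rho> \<gamma> \<theta> (marg D \<theta>) m s $ r)"

definition dr :: "real ^ 't ^ 'r \<Rightarrow> real ^ 't ^ 'r" where
  "dr \<theta> = plan \<theta> + dual \<theta>"

lemma step_cases:
  obtains (full) "step \<theta> = 1" "ereal (\<rho> * norm (\<theta> - bal_proj \<theta>)) \<le> \<gamma>"
  | (short) g where "\<gamma> = ereal g" "0 < g" "0 < step \<theta>" "step \<theta> < 1"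
      "step \<theta> * (\<rho> * norm (\<theta> - bal_proj \<theta>)) = g"
proof (cases "ereal (\<rho> * norm (\<theta> - bal_proj \<theta>)) \<le> \<gamma>")
  case True
  then show ?thesis using full by (simp add: step_def step_size_def marg_dev_eq)
next
  case False
  then obtain g where g: "\<gamma> = ereal g" using \<gamma>_pos by (cases \<gamma>) auto
  with False \<gamma>_pos have lt: "0 < g" "g < \<rho> * norm (\<theta> - bal_proj \<theta>)" by auto
  have st: "step \<theta> = g / (\<rho> * norm (\<theta> - bal_proj \<theta>))"
    using False unfolding step_def step_size_def marg_dev_eq by (simp add: g)
  have pos: "0 < \<rho> * norm (\<theta> - bal_proj \<theta>)" using lt by linarith
  show ?thesis
    by (rule short[OF g lt(1)]) (use lt pos in \<open>auto simp: st field_simps\<close>)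
qed

lemma dual_orthogonal: "y \<in> bal_space D \<Longrightarrow> dual \<theta> \<bullet> y = 0"
  by (simp add: dual_def bal_proj_orthogonal)

lemma dual_bound: "ereal (\<rho> * norm (dual \<theta>)) \<le> \<gamma>"
proof (cases rule: step_cases[of \<theta>])
  case full
  then show ?thesis by (simp add: dual_def)
next
  case (short g)
  have "\<rho> * norm (dual \<theta>) = g" using short(3,5) by (simp add: dual_def mult.left_commute)
  then show ?thesis using short(1) by (metis order_refl)
qed

text \<open>
  By Moreau's decomposition \<open>dual\<close> is a projection, onto the vectors that are orthogonal to the balance
  subspace and have norm at most \<open>\<gamma> / \<rho>\<close>.  If the step is short, \<open>dual \<theta>\<close>
  has maximal norm and is parallel to the normal component of \<open>\<theta>\<close>, and Cauchy--Schwarz suffices.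
\<close>

lemma dual_variational:
  assumes y: "\<And>b. b \<in> bal_space D \<Longrightarrow> y \<bullet> b = 0" and yb: "ereal (\<rho> * norm y) \<le> \<gamma>"
  shows "(\<theta> - dual \<theta>) \<bullet> (y - dual \<theta>) \<le> 0"
proof -
  define n where "n = \<theta> - bal_proj \<theta>"
  define t where "t = step \<theta>"
  have u: "dual \<theta> = t *\<^sub>R n" by (simp add: dual_def t_def n_def)
  have b0: "y \<bullet> bal_proj \<theta> = 0" "n \<bullet> bal_proj \<theta> = 0"
    using y bal_proj_in bal_proj_orthogonal by (auto simp: n_def)
  have th: "\<theta> = bal_proj \<theta> + n" by (simp add: n_def)
  have "(\<theta> - dual \<theta>) \<bullet> (y - dual \<theta>) = (bal_proj \<theta> + (1 - t) *\<^sub>R n) \<bullet> (y - t *\<^sub>R n)"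
    unfolding u by (subst th) (simp add: algebra_simps)
  also have "\<dots> = (1 - t) * (n \<bullet> y - t * (n \<bullet> n))"
    using b0 by (simp add: algebra_simps inner_commute)
  also have "\<dots> \<le> 0"
  proof (cases rule: step_cases[of \<theta>])
    case full
    then show ?thesis by (simp add: t_def)
  next
    case (short g)
    have eq: "\<rho> * (t * norm n) = g" using short(5) by (simp add: t_def n_def algebra_simps)
    have "\<rho> * norm y \<le> g" using yb short(1) by simp
    then have "norm y \<le> t * norm n" using eq \<rho>_pos by (metis mult_le_cancel_left_pos)
    then have "norm n * norm y \<le> norm n * (t * norm n)" by (intro mult_left_mono) auto
    also have "\<dots> = t * (n \<bullet> n)" by (simp add: power2_norm_eq_inner[symmetric] power2_eq_square)
    finally have "n \<bullet> y \<le> t * (n \<bullet> n)" using norm_cauchy_schwarz[of n y] by linarith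
    then show ?thesis using short(4) by (intro mult_nonneg_nonpos) (auto simp: t_def)
  qed
  finally show ?thesis .
qed

lemma proj_column_in:
  "m \<in> {1..M} \<Longrightarrow> s \<in> {1..S m} \<Longrightarrow> proj_column D \<rho> \<gamma> \<theta> pm m s \<in> simplex_of (mass D m s)"
  unfolding proj_column_def
  by (intro closest_point_in_set simplex_of_closed simplex_of_nonempty mass_nonneg)

lemma plan_col:
  "m \<in> {1..M} \<Longrightarrow> s \<in> {1..S m} \<Longrightarrow> plan \<theta> $ r $ col D m s = proj_column D \<rho> \<gamma> \<theta> (marg D \<theta>) m s $ r"
  by (simp add: plan_def)

lemma plan_in: "plan \<theta> \<in> all_plans"
  using proj_column_in by (auto simp: all_plans_def plans_def plan_col simplex_of_def)

lemma dual_col: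
  "m \<in> {1..M} \<Longrightarrow> s \<in> {1..S m} \<Longrightarrow>
    dual \<theta> $ r $ col D m s = - (step \<theta> * ((avg \<theta> $ r - marg D \<theta> m $ r) / real (S m)))"
  by (simp add: dual_def bal_proj_def)

text \<open>
  \<open>plan \<theta>\<close> is the projection onto the plans of the reflected point \<open>\<theta> - 2 *\<^sub>R dual \<theta>\<close>, shifted by the
  cost.  The set of plans is a product over the columns, so the columnwise inequalities
  add up.
\<close>

lemma plan_variational:
  assumes y: "y \<in> all_plans"
  shows "(\<theta> - 2 *\<^sub>R dual \<theta> - (1 / \<rho>) *\<^sub>R cost_matrix - plan \<theta>) \<bullet> (y - plan \<theta>) \<le> 0"
  unfolding inner_matrix sum_columns
proof (rule sum_nonpos, rule sum_nonpos)
  fix m s assume m: "m \<in> {1..M}" and s: "s \<in> {1..S m}"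
  define a where "a = (\<chi> r. \<theta> $ r $ col D m s
          + 2 * step_size D \<rho> \<gamma> (marg D \<theta>) * ((avg_marg D (marg D \<theta>) $ r - marg D \<theta> m $ r) / real (nsupp D m))
          - (1 / \<rho>) * cost D m r s)"
  define x where "x = proj_column D \<rho> \<gamma> \<theta> (marg D \<theta>) m s"
  define z where "z = (\<chi> r. y $ r $ col D m s)"
  have z: "z \<in> simplex_of (mass D m s)"
    using y m s by (auto simp: z_def simplex_of_def all_plans_def plans_def)
  have "(a - x) \<bullet> (z - x) \<le> 0"
    unfolding x_def proj_column_def a_def[symmetric]
    using closest_point_dot[OF simplex_of_convex simplex_of_closed z] .
  also have "(a - x) \<bullet> (z - x) = (\<Sum>r\<in>UNIV. (\<theta> - 2 *\<^sub>R dual \<theta> - (1 / \<rho>) *\<^sub>R cost_matrix - plan \<theta>) $ r $ col D m s *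
             (y - plan \<theta>) $ r $ col D m s)"
    unfolding inner_vec_def
    using m s by (intro sum.cong refl)
      (simp add: a_def x_def z_def plan_col dual_col cost_matrix_def step_def avg_def)
  finally show "(\<Sum>r\<in>UNIV. (\<theta> - 2 *\<^sub>R dual \<theta> - (1 / \<rho>) *\<^sub>R cost_matrix - plan \<theta>) $ r $ col D m s *
             (y - plan \<theta>) $ r $ col D m s) \<le> 0" .
qed

text \<open>
  The standard computation for Douglas--Rachford: the defect equals twice the sum of the two firmness
  expressions, of \<open>dual\<close> and of \<open>plan\<close> at the reflected points.
\<close>

lemma dr_firm: "(norm (dr x - dr z))\<^sup>2 + (norm ((x - z) - (dr x - dr z)))\<^sup>2 \<le> (norm (x - z))\<^sup>2"
proof -
  define d where "d = x - z"
  define w where "w = dual x - dual z"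
  define p where "p = plan x - plan z"
  have 1: "0 \<le> w \<bullet> (d - w)"
    unfolding w_def d_def
    by (intro firm_of_variational dual_variational dual_orthogonal dual_bound)
  have "0 \<le> p \<bullet> (((x - 2 *\<^sub>R dual x - (1 / \<rho>) *\<^sub>R cost_matrix) - (z - 2 *\<^sub>R dual z - (1 / \<rho>) *\<^sub>R cost_matrix)) - p)"
    unfolding p_def by (intro firm_of_variational plan_variational plan_in)
  also have "((x - 2 *\<^sub>R dual x - (1 / \<rho>) *\<^sub>R cost_matrix) - (z - 2 *\<^sub>R dual z - (1 / \<rho>) *\<^sub>R cost_matrix)) = d - 2 *\<^sub>R w"
    by (simp add: d_def w_def algebra_simps)
  finally have 2: "0 \<le> p \<bullet> ((d - 2 *\<^sub>R w) - p)" .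
  have "dr x - dr z = p + w" by (simp add: dr_def p_def w_def)
  moreover have "(norm d)\<^sup>2 - (norm (p + w))\<^sup>2 - (norm (d - (p + w)))\<^sup>2
      = 2 * (p \<bullet> ((d - 2 *\<^sub>R w) - p)) + 2 * (w \<bullet> (d - w))"
    unfolding power2_norm_eq_inner by (simp add: algebra_simps inner_commute)
  ultimately show ?thesis using 1 2 unfolding d_def[symmetric] by simp
qed

lemma dr_nonexpansive: "norm (dr x - dr z) \<le> norm (x - z)"
proof (rule power2_le_imp_le)
  show "(norm (dr x - dr z))\<^sup>2 \<le> (norm (x - z))\<^sup>2"
    using dr_firm[of x z] zero_le_power2[of "norm ((x - z) - (dr x - dr z))"] by linarith
qed simp

lemma dr_continuous: "continuous_on UNIV dr"
proof (rule continuous_onI)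
  fix x :: "real ^ 't ^ 'r" and e :: real assume "0 < e"
  moreover have "dist (dr x') (dr x) \<le> e" if "dist x' x < e" for x'
    using dr_nonexpansive[of x' x] that by (simp add: dist_norm)
  ultimately show "\<exists>d>0. \<forall>x'\<in>UNIV. dist x' x < d \<longrightarrow> dist (dr x') (dr x) \<le> e" by blast
qed

text \<open>
  At a fixed point \<open>plan \<theta> = \<theta> - dual \<theta>\<close>, so the inequality for \<open>plan\<close> says that
  \<open>- \<rho> *\<^sub>R dual \<theta>\<close> is a subgradient of the cost restricted to the plans, at \<open>plan \<theta>\<close>.
\<close>

lemma fixed_point_optimal:
  assumes fp: "dr \<theta> = \<theta>" and y: "y \<in> all_plans"
  shows "total_cost D (plan \<theta>) \<le> total_cost D y + \<rho> * (dual \<theta> \<bullet> (y - plan \<theta>))"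
proof -
  have "plan \<theta> = \<theta> - dual \<theta>" using fp unfolding dr_def by (simp add: eq_diff_eq)
  then have "\<theta> - 2 *\<^sub>R dual \<theta> - (1 / \<rho>) *\<^sub>R cost_matrix - plan \<theta> = - dual \<theta> - (1 / \<rho>) *\<^sub>R cost_matrix"
    by (simp add: scaleR_2)
  with plan_variational[OF y, of \<theta>]
  have "(- dual \<theta> - (1 / \<rho>) *\<^sub>R cost_matrix) \<bullet> (y - plan \<theta>) \<le> 0" by simp
  then have "0 \<le> \<rho> * (dual \<theta> \<bullet> (y - plan \<theta>) + (1 / \<rho>) * (cost_matrix \<bullet> (y - plan \<theta>)))"
    using \<rho>_pos by (simp add: inner_diff_left)
  also have "\<dots> = \<rho> * (dual \<theta> \<bullet> (y - plan \<theta>)) + (cost_matrix \<bullet> y - cost_matrix \<bullet> plan \<theta>)"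
    using \<rho>_pos by (simp add: distrib_left inner_diff_right)
  finally show ?thesis by (simp add: total_cost_eq)
qed

lemma fixed_point_plan: "dr \<theta> = \<theta> \<Longrightarrow> plan \<theta> = bal_proj \<theta> + (1 - step \<theta>) *\<^sub>R (\<theta> - bal_proj \<theta>)"
proof -
  assume "dr \<theta> = \<theta>"
  then have "plan \<theta> = \<theta> - dual \<theta>" unfolding dr_def by (simp add: eq_diff_eq)
  then show ?thesis by (simp add: dual_def algebra_simps)
qed

lemma fixed_point_bal_proj: "dr \<theta> = \<theta> \<Longrightarrow> bal_proj (plan \<theta>) = bal_proj \<theta>"
  unfolding fixed_point_plan by (rule bal_proj_unique) (auto simp: bal_proj_in bal_proj_orthogonal)

text \<open>
  The functional \<open>\<lambda>y. \<rho> * (dual \<theta> \<bullet> y)\<close> of \<open>fixed_point_optimal\<close> lies below the penalty and touches it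
  at \<open>plan \<theta>\<close>.
\<close>

lemma unbalanced_optimal:
  assumes fp: "dr \<theta> = \<theta>" and g: "\<gamma> = ereal g" and y: "y \<in> all_plans"
  shows "total_cost D (plan \<theta>) + g * infdist (plan \<theta>) (bal_space D)
    \<le> total_cost D y + g * infdist y (bal_space D)"
proof -
  define n where "n = \<theta> - bal_proj \<theta>"
  have pn: "plan \<theta> - bal_proj (plan \<theta>) = (1 - step \<theta>) *\<^sub>R n"
    using fixed_point_bal_proj[OF fp] fixed_point_plan[OF fp] by (simp add: n_def)
  have 1: "\<rho> * (dual \<theta> \<bullet> y) \<le> g * infdist y (bal_space D)"
  proof -
    have "dual \<theta> \<bullet> y = dual \<theta> \<bullet> (y - bal_proj y)"
      by (simp add: inner_diff_right dual_orthogonal bal_proj_in)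
    also have "\<dots> \<le> norm (dual \<theta>) * norm (y - bal_proj y)" by (rule norm_cauchy_schwarz)
    finally have "\<rho> * (dual \<theta> \<bullet> y) \<le> (\<rho> * norm (dual \<theta>)) * norm (y - bal_proj y)"
      using \<rho>_pos by (simp add: algebra_simps)
    also have "\<dots> \<le> g * norm (y - bal_proj y)"
      using dual_bound[of \<theta>] g by (intro mult_right_mono) auto
    finally show ?thesis by (simp add: infdist_bal_space)
  qed
  have 2: "\<rho> * (dual \<theta> \<bullet> plan \<theta>) = g * infdist (plan \<theta>) (bal_space D)"
  proof -
    have "dual \<theta> \<bullet> plan \<theta> = dual \<theta> \<bullet> (plan \<theta> - bal_proj (plan \<theta>))"
      by (simp add: inner_diff_right dual_orthogonal bal_proj_in)
    also have "\<dots> = step \<theta> * (1 - step \<theta>) * (n \<bullet> n)"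
      unfolding pn by (simp add: dual_def n_def)
    finally have eq: "dual \<theta> \<bullet> plan \<theta> = step \<theta> * (1 - step \<theta>) * (norm n * norm n)"
      by (simp add: power2_norm_eq_inner[symmetric] power2_eq_square)
    show ?thesis
    proof (cases rule: step_cases[of \<theta>])
      case full
      then show ?thesis using eq by (simp add: infdist_bal_space pn)
    next
      case (short g')
      then have "g' = g" using g by simp
      with short(5) have "step \<theta> * (\<rho> * norm n) = g" by (simp add: n_def)
      moreover have "infdist (plan \<theta>) (bal_space D) = (1 - step \<theta>) * norm n"
        using short(4) by (simp add: infdist_bal_space pn)
      moreover have "\<rho> * (dual \<theta> \<bullet> plan \<theta>) = step \<theta> * (\<rho> * norm n) * ((1 - step \<theta>) * norm n)"
        unfolding eq by (simp add: algebra_simps)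
      ultimately show ?thesis by simp
    qed
  qed
  from fixed_point_optimal[OF fp y] 1 2 show ?thesis
    by (simp add: inner_diff_right algebra_simps)
qed

section \<open>Existence of fixed points\<close>

text \<open>
  For finite \<open>\<gamma>\<close> the range of \<open>dr\<close> is bounded: plans are bounded by the total mass, dual vectors by
  \<open>\<gamma> / \<rho>\<close>.  Hence \<open>dr\<close> maps a ball into itself.
\<close>

lemma fixed_point_finite:
  assumes g: "\<gamma> = ereal g"
  shows "\<exists>\<theta>. dr \<theta> = \<theta>"
proof -
  define R where "R = (\<Sum>m=1..M. \<Sum>s=1..S m. mass D m s) + g / \<rho>"
  have bd: "norm (dr \<theta>) \<le> R" for \<theta>
  proof -
    have "\<rho> * norm (dual \<theta>) \<le> g" using dual_bound[of \<theta>] g by simp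
    then have "norm (dual \<theta>) \<le> g / \<rho>" using \<rho>_pos by (simp add: field_simps)
    with all_plans_norm_le[OF plan_in[of \<theta>]] norm_triangle_ineq[of "plan \<theta>" "dual \<theta>"]
    show ?thesis by (simp add: dr_def R_def)
  qed
  have "0 \<le> R" using bd[of 0] norm_ge_zero order_trans by blast
  then have "cball 0 R \<noteq> {}" by simp
  moreover have "dr \<in> cball 0 R \<rightarrow> cball 0 R" using bd by auto
  ultimately show ?thesis
    using brouwer[OF compact_cball convex_cball _ continuous_on_subset[OF dr_continuous]] by blast
qed

end

text \<open>
  A nonnegative matrix \<open>f\<close> can be given new row sums \<open>p\<close>, with the same total, without changing its
  column sums, at a cost at most proportional to the change of the row sums: scale down the rows with excess and
  hand the freed mass of each column to the rows with a deficit, in proportion to their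
  deficits.
\<close>

lemma repair_plan:
  fixes f k :: "'r::finite \<Rightarrow> 's \<Rightarrow> real" and p :: "'r \<Rightarrow> real"
  assumes fin: "finite A"
    and f: "\<And>r s. s \<in> A \<Longrightarrow> 0 \<le> f r s"
    and p: "\<And>r. 0 \<le> p r" and total: "(\<Sum>r\<in>UNIV. p r) = (\<Sum>r\<in>UNIV. \<Sum>s\<in>A. f r s)"
    and k: "\<And>r s. s \<in> A \<Longrightarrow> 0 \<le> k r s \<and> k r s \<le> K" and K: "0 \<le> K"
  shows "\<exists>g. (\<forall>r. \<forall>s\<in>A. 0 \<le> g r s) \<and> (\<forall>s\<in>A. (\<Sum>r\<in>UNIV. g r s) = (\<Sum>r\<in>UNIV. f r s)) \<and>
    (\<forall>r. (\<Sum>s\<in>A. g r s) = p r) \<and>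
    (\<Sum>r\<in>UNIV. \<Sum>s\<in>A. k r s * g r s)
      \<le> (\<Sum>r\<in>UNIV. \<Sum>s\<in>A. k r s * f r s) + K * (\<Sum>r\<in>UNIV. \<bar>p r - (\<Sum>s\<in>A. f r s)\<bar>)"
proof -
  \<comment> \<open>\<open>d\<close>: excess, \<open>e\<close>: deficit of a row, with equal sums \<open>E\<close>; \<open>a\<close>: mass taken away, \<open>\<delta>\<close>: its column sums.
     If \<open>E = 0\<close> nothing moves, and the divisions by 0 yield 0 as they should.\<close>
  define P where "P r = (\<Sum>s\<in>A. f r s)" for r
  define d where "d r = max 0 (P r - p r)" for r
  define e where "e r = max 0 (p r - P r)" for r
  define E where "E = (\<Sum>r\<in>UNIV. e r)"
  define a where "a r s = f r s * d r / P r" for r s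
  define \<delta> where "\<delta> s = (\<Sum>r\<in>UNIV. a r s)" for s
  define g where "g r s = f r s - a r s + e r * \<delta> s / E" for r s
  have P0: "0 \<le> P r" for r unfolding P_def by (intro sum_nonneg f)
  have d0: "0 \<le> d r" and dP: "d r \<le> P r" and e0: "0 \<le> e r" for r
    using P0[of r] p[of r] by (auto simp: d_def e_def)
  have "(\<Sum>r\<in>UNIV. e r) - (\<Sum>r\<in>UNIV. d r) = (\<Sum>r\<in>UNIV. p r) - (\<Sum>r\<in>UNIV. P r)"
    unfolding sum_subtractf[symmetric] by (intro sum.cong refl) (auto simp: d_def e_def)
  then have Ed: "E = (\<Sum>r\<in>UNIV. d r)" using total by (simp add: E_def P_def)
  have a0: "0 \<le> a r s" if "s \<in> A" for r s
    using f[OF that] d0 P0 by (simp add: a_def)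
  have af: "a r s \<le> f r s" if "s \<in> A" for r s
  proof (cases "P r = 0")
    case False
    then have "d r / P r \<le> 1" using dP[of r] P0[of r] by simp
    then have "f r s * (d r / P r) \<le> f r s * 1" by (intro mult_left_mono f that)
    then show ?thesis by (simp add: a_def)
  qed (simp add: a_def f that)
  have a_row: "(\<Sum>s\<in>A. a r s) = d r" for r
  proof -
    have "(\<Sum>s\<in>A. a r s) = P r * d r / P r"
      by (simp add: a_def P_def sum_divide_distrib sum_distrib_right)
    then show ?thesis using d0[of r] dP[of r] by (cases "P r = 0") auto
  qed
  have \<delta>0: "0 \<le> \<delta> s" if "s \<in> A" for s unfolding \<delta>_def by (intro sum_nonneg a0 that)
  have \<delta>_sum: "(\<Sum>s\<in>A. \<delta> s) = E"
    unfolding \<delta>_def Ed by (subst sum.swap) (simp add: a_row)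
  have E0: "0 \<le> E" unfolding E_def by (intro sum_nonneg e0)
  have e_zero: "e r = 0" if "E = 0" for r
    using that sum_nonneg_eq_0_iff[of UNIV e] e0 by (auto simp: E_def)
  have \<delta>_zero: "\<delta> s = 0" if "E = 0" "s \<in> A" for s
    using that \<delta>_sum sum_nonneg_eq_0_iff[OF fin, of \<delta>] \<delta>0 by auto
  have g0: "0 \<le> g r s" if "s \<in> A" for r s
    using af[OF that, of r] e0[of r] \<delta>0[OF that] E0 by (simp add: g_def)
  have g_col: "(\<Sum>r\<in>UNIV. g r s) = (\<Sum>r\<in>UNIV. f r s)" if s: "s \<in> A" for s
  proof -
    have "(\<Sum>r\<in>UNIV. e r * \<delta> s / E) = E * \<delta> s / E"
      by (simp add: E_def sum_distrib_right sum_divide_distrib)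
    also have "\<dots> = \<delta> s" using \<delta>_zero[OF _ s] by (cases "E = 0") auto
    finally show ?thesis by (simp add: g_def sum.distrib sum_subtractf \<delta>_def)
  qed
  have g_row: "(\<Sum>s\<in>A. g r s) = p r" for r
  proof -
    have "(\<Sum>s\<in>A. e r * \<delta> s / E) = e r * E / E"
      unfolding \<delta>_sum[symmetric] by (simp add: sum_distrib_left sum_divide_distrib)
    also have "\<dots> = e r" using e_zero[of r] by (cases "E = 0") auto
    finally have "(\<Sum>s\<in>A. g r s) = P r - d r + e r"
      by (simp add: g_def sum.distrib sum_subtractf a_row P_def)
    then show ?thesis by (auto simp: d_def e_def)
  qed
  have "(\<Sum>r\<in>UNIV. \<Sum>s\<in>A. k r s * g r s)
      \<le> (\<Sum>r\<in>UNIV. \<Sum>s\<in>A. k r s * f r s + K * (e r * \<delta> s / E))"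
  proof (intro sum_mono)
    fix r s assume s: "s \<in> A"
    have x: "0 \<le> e r * \<delta> s / E" using e0[of r] \<delta>0[OF s] E0 by simp
    have ka: "0 \<le> k r s * a r s" using k[OF s, of r] a0[OF s, of r] by simp
    have kx: "k r s * (e r * \<delta> s / E) \<le> K * (e r * \<delta> s / E)"
      using k[OF s, of r] x by (intro mult_right_mono) auto
    have "k r s * g r s = k r s * f r s - k r s * a r s + k r s * (e r * \<delta> s / E)"
      unfolding g_def by (simp add: algebra_simps)
    also have "\<dots> \<le> k r s * f r s - 0 + K * (e r * \<delta> s / E)"
      using ka kx by linarith
    finally show "k r s * g r s \<le> k r s * f r s + K * (e r * \<delta> s / E)" by simp
  qed
  also have "\<dots> = (\<Sum>r\<in>UNIV. \<Sum>s\<in>A. k r s * f r s) + K * (\<Sum>r\<in>UNIV. \<Sum>s\<in>A. e r * \<delta> s / E)"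
    by (simp add: sum.distrib sum_distrib_left)
  also have "(\<Sum>r\<in>UNIV. \<Sum>s\<in>A. e r * \<delta> s / E) = E * E / E"
  proof -
    have "(\<Sum>r\<in>UNIV. \<Sum>s\<in>A. e r * \<delta> s / E) = (\<Sum>r\<in>UNIV. e r * E / E)"
      unfolding \<delta>_sum[symmetric] by (simp add: sum_distrib_left sum_divide_distrib)
    then show ?thesis by (simp add: E_def sum_distrib_right sum_divide_distrib)
  qed
  also have "(\<Sum>r\<in>UNIV. \<Sum>s\<in>A. k r s * f r s) + K * (E * E / E)
      \<le> (\<Sum>r\<in>UNIV. \<Sum>s\<in>A. k r s * f r s) + K * (\<Sum>r\<in>UNIV. \<bar>p r - P r\<bar>)"
  proof -
    have "E \<le> (\<Sum>r\<in>UNIV. \<bar>p r - P r\<bar>)" unfolding E_def by (intro sum_mono) (auto simp: e_def)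
    then show ?thesis using K by (simp add: mult_left_mono)
  qed
  finally show ?thesis
    by (intro exI[of _ g] conjI allI ballI g0 g_col g_row) (auto simp: P_def)
qed

context wb
begin

lemma all_plans_col_nonneg: "\<pi> \<in> all_plans \<Longrightarrow> 0 \<le> \<pi> $ r $ c"
  by (rule column_cases[of c]) (auto simp: all_plans_def plans_def)

lemma all_plans_col_sum: "\<pi> \<in> all_plans \<Longrightarrow> m \<in> {1..M} \<Longrightarrow> s \<in> {1..S m} \<Longrightarrow>
    (\<Sum>r\<in>UNIV. \<pi> $ r $ col D m s) = mass D m s"
  by (auto simp: all_plans_def plans_def)

lemma marg_sum: "\<pi> \<in> all_plans \<Longrightarrow> m \<in> {1..M} \<Longrightarrow> (\<Sum>r\<in>UNIV. marg D \<pi> m $ r) = (\<Sum>s=1..S m. mass D m s)"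
  unfolding marg_def vec_lambda_beta by (subst sum.swap) (simp add: all_plans_col_sum)

lemma avg_weight_nonneg: "m \<in> {1..M} \<Longrightarrow> 0 \<le> avg_weight D m"
  using inv_S_sum_pos unfolding avg_weight_def by auto

lemma avg_weight_sum: "(\<Sum>m=1..M. avg_weight D m) = 1"
proof -
  have "(\<Sum>m=1..M. avg_weight D m) = (\<Sum>m=1..M. 1 / real (S m)) / (\<Sum>m=1..M. 1 / real (S m))"
    unfolding avg_weight_def by (rule sum_divide_distrib[symmetric])
  then show ?thesis using inv_S_sum_pos by (simp del: One_nat_def)
qed

lemma cost_matrix_nonneg: "0 \<le> cost_matrix $ r $ c"
  using valid by (cases c rule: column_cases) (auto simp: cost_matrix_def cost_def valid_data_def)

lemma cost_matrix_le: "cost_matrix $ r $ c \<le> (\<Sum>c\<in>UNIV. \<Sum>r\<in>UNIV. cost_matrix $ r $ c)"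
proof -
  have "cost_matrix $ r $ c \<le> (\<Sum>r\<in>UNIV. cost_matrix $ r $ c)"
    by (rule member_le_sum) (auto simp: cost_matrix_nonneg)
  also have "\<dots> \<le> (\<Sum>c\<in>UNIV. \<Sum>r\<in>UNIV. cost_matrix $ r $ c)"
    by (rule member_le_sum) (auto simp: cost_matrix_nonneg sum_nonneg)
  finally show ?thesis .
qed

lemma avg_in_simplex:
  assumes "has_totals D \<tau>" "\<pi> \<in> all_plans"
  shows "avg \<pi> \<in> simplex_of \<tau>"
proof -
  have "0 \<le> avg \<pi> $ r" for r
    unfolding avg_def avg_marg_def
    by (auto intro!: sum_nonneg mult_nonneg_nonneg avg_weight_nonneg all_plans_col_nonneg assms simp: marg_def)
  moreover have "(\<Sum>r\<in>UNIV. avg \<pi> $ r) = \<tau>"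
  proof -
    have "(\<Sum>r\<in>UNIV. avg \<pi> $ r) = (\<Sum>m=1..M. avg_weight D m * (\<Sum>r\<in>UNIV. marg D \<pi> m $ r))"
      unfolding avg_def avg_marg_def by (simp add: sum_distrib_left) (rule sum.swap)
    also have "\<dots> = (\<Sum>m=1..M. avg_weight D m * \<tau>)"
      using assms by (intro sum.cong refl) (simp add: marg_sum has_totals_def)
    also have "\<dots> = \<tau>" by (simp add: sum_distrib_right[symmetric] avg_weight_sum del: One_nat_def)
    finally show ?thesis .
  qed
  ultimately show ?thesis by (simp add: simplex_of_def)
qed

text \<open>
  Repairing every block to the common marginal \<open>avg \<pi>\<close> gives a balanced plan.  The change of a marginal
  entry is, up to sign, \<open>S m\<close> times an entry of \<open>\<pi> - bal_proj \<pi>\<close>, so the extra cost is linear in the distance to the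
  balance subspace.  Equal totals are what makes \<open>avg \<pi>\<close> an admissible marginal.
\<close>

lemma exact_penalty:
  assumes tot: "has_totals D \<tau>"
  shows "\<exists>L\<ge>0. \<forall>\<pi>\<in>all_plans. \<exists>\<pi>'\<in>all_plans \<inter> bal_space D.
    total_cost D \<pi>' \<le> total_cost D \<pi> + L * norm (\<pi> - bal_proj \<pi>)"
proof -
  define K where "K = (\<Sum>c\<in>UNIV. \<Sum>r\<in>UNIV. cost_matrix $ r $ c)"
  have K0: "0 \<le> K" unfolding K_def by (intro sum_nonneg cost_matrix_nonneg)
  define L where "L = K * (\<Sum>m=1..M. \<Sum>r\<in>(UNIV::'r set). real (S m))"
  have L0: "0 \<le> L" unfolding L_def by (intro mult_nonneg_nonneg K0 sum_nonneg) auto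
  have "\<exists>\<pi>'\<in>all_plans \<inter> bal_space D. total_cost D \<pi>' \<le> total_cost D \<pi> + L * norm (\<pi> - bal_proj \<pi>)"
    if \<pi>: "\<pi> \<in> all_plans" for \<pi>
  proof -
    have av: "avg \<pi> \<in> simplex_of \<tau>" by (rule avg_in_simplex[OF tot \<pi>])
    have "\<forall>m\<in>{1..M}. \<exists>g. (\<forall>r. \<forall>s\<in>{1..S m}. 0 \<le> g r s) \<and>
      (\<forall>s\<in>{1..S m}. (\<Sum>r\<in>UNIV. g r s) = mass D m s) \<and>
      (\<forall>r. (\<Sum>s=1..S m. g r s) = avg \<pi> $ r) \<and>
      (\<Sum>r\<in>UNIV. \<Sum>s=1..S m. cost D m r s * g r s)
       \<le> (\<Sum>r\<in>UNIV. \<Sum>s=1..S m. cost D m r s * \<pi> $ r $ col D m s)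
         + K * (\<Sum>r\<in>UNIV. \<bar>avg \<pi> $ r - marg D \<pi> m $ r\<bar>)"
    proof
      fix m assume m: "m \<in> {1..M}"
      have cb: "0 \<le> cost D m r s \<and> cost D m r s \<le> K" if "s \<in> {1..S m}" for r s
        using cost_matrix_nonneg[of r "col D m s"] cost_matrix_le[of r "col D m s"] m that
        by (simp add: cost_matrix_def K_def)
      have "(\<Sum>r\<in>UNIV. avg \<pi> $ r) = (\<Sum>r\<in>UNIV. \<Sum>s=1..S m. \<pi> $ r $ col D m s)"
        using av marg_sum[OF \<pi> m] tot m by (simp add: simplex_of_def has_totals_def marg_def)
      from repair_plan[of "{1..S m}" "\<lambda>r s. \<pi> $ r $ col D m s" "\<lambda>r. avg \<pi> $ r" "cost D m" K,
          OF _ _ _ this cb K0]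
      obtain g where "\<forall>r. \<forall>s\<in>{1..S m}. 0 \<le> g r s"
        "\<forall>s\<in>{1..S m}. (\<Sum>r\<in>UNIV. g r s) = (\<Sum>r\<in>UNIV. \<pi> $ r $ col D m s)"
        "\<forall>r. (\<Sum>s=1..S m. g r s) = avg \<pi> $ r"
        "(\<Sum>r\<in>UNIV. \<Sum>s=1..S m. cost D m r s * g r s)
       \<le> (\<Sum>r\<in>UNIV. \<Sum>s=1..S m. cost D m r s * \<pi> $ r $ col D m s)
         + K * (\<Sum>r\<in>UNIV. \<bar>avg \<pi> $ r - (\<Sum>s=1..S m. \<pi> $ r $ col D m s)\<bar>)"
        using av all_plans_col_nonneg[OF \<pi>] by (auto simp: simplex_of_def)
      then show "\<exists>g. (\<forall>r. \<forall>s\<in>{1..S m}. 0 \<le> g r s) \<and>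
      (\<forall>s\<in>{1..S m}. (\<Sum>r\<in>UNIV. g r s) = mass D m s) \<and>
      (\<forall>r. (\<Sum>s=1..S m. g r s) = avg \<pi> $ r) \<and>
      (\<Sum>r\<in>UNIV. \<Sum>s=1..S m. cost D m r s * g r s)
       \<le> (\<Sum>r\<in>UNIV. \<Sum>s=1..S m. cost D m r s * \<pi> $ r $ col D m s)
         + K * (\<Sum>r\<in>UNIV. \<bar>avg \<pi> $ r - marg D \<pi> m $ r\<bar>)"
        using all_plans_col_sum[OF \<pi> m] by (intro exI[of _ g]) (auto simp: marg_def)
    qed
    from bchoice[OF this] obtain g where g:
      "\<And>m r s. m \<in> {1..M} \<Longrightarrow> s \<in> {1..S m} \<Longrightarrow> 0 \<le> g m r s"
      "\<And>m s. m \<in> {1..M} \<Longrightarrow> s \<in> {1..S m} \<Longrightarrow> (\<Sum>r\<in>UNIV. g m r s) = mass D m s"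
      "\<And>m r. m \<in> {1..M} \<Longrightarrow> (\<Sum>s=1..S m. g m r s) = avg \<pi> $ r"
      "\<And>m. m \<in> {1..M} \<Longrightarrow> (\<Sum>r\<in>UNIV. \<Sum>s=1..S m. cost D m r s * g m r s)
       \<le> (\<Sum>r\<in>UNIV. \<Sum>s=1..S m. cost D m r s * \<pi> $ r $ col D m s)
         + K * (\<Sum>r\<in>UNIV. \<bar>avg \<pi> $ r - marg D \<pi> m $ r\<bar>)"
      by blast
    define \<pi>' :: "real ^ 't ^ 'r" where "\<pi>' = (\<chi> r c. case position D c of (m, s) \<Rightarrow> g m r s)"
    have ent: "\<pi>' $ r $ col D m s = g m r s" if "m \<in> {1..M}" "s \<in> {1..S m}" for m r s
      using that by (simp add: \<pi>'_def)
    have "\<pi>' \<in> all_plans" using g(1,2) by (auto simp: all_plans_def plans_def ent)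
    moreover have mg: "marg D \<pi>' m = avg \<pi>" if "m \<in> {1..M}" for m
      using g(3)[OF that] that by (simp add: marg_def vec_eq_iff ent)
    then have "\<pi>' \<in> bal_space D" using M_pos by (simp add: bal_space_iff)
    moreover have "total_cost D \<pi>' \<le> total_cost D \<pi> + L * norm (\<pi> - bal_proj \<pi>)"
    proof -
      have dev: "\<bar>avg \<pi> $ r - marg D \<pi> m $ r\<bar> \<le> real (S m) * norm (\<pi> - bal_proj \<pi>)"
        if m: "m \<in> {1..M}" for m r
      proof -
        have "1 \<in> {1..S m}" using S_pos[OF m] by auto
        then have "\<bar>avg \<pi> $ r - marg D \<pi> m $ r\<bar> = real (S m) * \<bar>(\<pi> - bal_proj \<pi>) $ r $ col D m 1\<bar>"
          using m S_pos[OF m] by (simp add: bal_proj_def)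
        then show ?thesis using entry_le_norm[of "\<pi> - bal_proj \<pi>" r "col D m 1"]
          by (simp add: mult_left_mono)
      qed
      have "total_cost D \<pi>' = (\<Sum>m=1..M. \<Sum>r\<in>UNIV. \<Sum>s=1..S m. cost D m r s * g m r s)"
        unfolding total_cost_def by (intro sum.cong refl) (simp add: ent)
      also have "\<dots> \<le> (\<Sum>m=1..M. (\<Sum>r\<in>UNIV. \<Sum>s=1..S m. cost D m r s * \<pi> $ r $ col D m s)
         + K * (\<Sum>r\<in>(UNIV::'r set). real (S m) * norm (\<pi> - bal_proj \<pi>)))"
        by (intro sum_mono order_trans[OF g(4)] add_left_mono mult_left_mono K0 dev) auto
      also have "\<dots> = total_cost D \<pi> + L * norm (\<pi> - bal_proj \<pi>)"
        by (simp add: total_cost_def L_def sum.distrib sum_distrib_left sum_distrib_right algebra_simps)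
      finally show ?thesis .
    qed
    ultimately show ?thesis by blast
  qed
  with L0 show ?thesis by blast
qed

end

context mam
begin

lemma step_infinite: "\<gamma> = \<infinity> \<Longrightarrow> step \<theta> = 1"
  unfolding step_def step_size_def by simp

text \<open>
  With a finite penalty above the constant of \<open>exact_penalty\<close> the optimal plan is balanced, which forces
  the step size 1.  At such a point the operators for the finite and the infinite penalty coincide.
\<close>

lemma fixed_point_balanced:
  assumes bal: "balanced D" and inf: "\<gamma> = \<infinity>"
  shows "\<exists>\<theta>. dr \<theta> = \<theta>"
proof -
  obtain \<tau> where "has_totals D \<tau>" using bal by (auto simp: balanced_def)
  from exact_penalty[OF this] obtain L where L: "0 \<le> L"
    "\<And>\<pi>. \<pi> \<in> all_plans \<Longrightarrow> \<exists>\<pi>'\<in>all_plans \<inter> bal_space D. total_cost D \<pi>' \<le> total_cost D \<pi> + L * norm (\<pi> - bal_proj \<pi>)"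
    by blast
  interpret fin: mam D \<rho> "ereal (L + 1)"
    by unfold_locales (use L(1) \<rho>_pos in auto)
  obtain \<theta> where fp: "fin.dr \<theta> = \<theta>" using fin.fixed_point_finite by blast
  define n where "n = \<theta> - bal_proj \<theta>"
  obtain \<pi>' where \<pi>': "\<pi>' \<in> all_plans" "\<pi>' \<in> bal_space D"
    "total_cost D \<pi>' \<le> total_cost D (fin.plan \<theta>) + L * norm (fin.plan \<theta> - bal_proj (fin.plan \<theta>))"
    using L(2)[OF fin.plan_in] by blast
  have "total_cost D (fin.plan \<theta>) + (L + 1) * norm (fin.plan \<theta> - bal_proj (fin.plan \<theta>)) \<le> total_cost D \<pi>'"
    using fin.unbalanced_optimal[OF fp refl \<pi>'(1)] \<pi>'(2) by (simp add: infdist_bal_space[symmetric])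
  with \<pi>'(3) have "norm (fin.plan \<theta> - bal_proj (fin.plan \<theta>)) \<le> 0"
    unfolding distrib_right mult_1 by linarith
  then have "(1 - fin.step \<theta>) *\<^sub>R n = 0"
    using fin.fixed_point_bal_proj[OF fp] fin.fixed_point_plan[OF fp] by (simp add: n_def)
  then have fs: "fin.step \<theta> = 1"
    by (cases rule: fin.step_cases[of \<theta>]) (auto simp: n_def)
  have s1: "step \<theta> = 1" by (rule step_infinite[OF inf])
  have pc: "proj_column D \<rho> \<gamma> \<theta> (marg D \<theta>) m s = proj_column D \<rho> (ereal (L + 1)) \<theta> (marg D \<theta>) m s" for m s
    using s1 fs unfolding proj_column_def step_def fin.step_def by simp
  have "dr \<theta> = fin.dr \<theta>"
    unfolding dr_def fin.dr_def plan_def fin.plan_def dual_def fin.dual_def by (simp add: s1 fs pc)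
  then show ?thesis using fp by auto
qed

section \<open>Fixed points yield barycenters\<close>

text \<open>
  Here \<open>plan \<theta> = bal_proj \<theta>\<close> is balanced, and the linear term of \<open>fixed_point_optimal\<close> vanishes on
  balanced plans.
\<close>

lemma balanced_barycenter_of_fixed_point:
  assumes fp: "dr \<theta> = \<theta>" and bal: "balanced D" and inf: "\<gamma> = \<infinity>"
  shows "balanced_barycenter D (avg \<theta>)"
proof -
  obtain \<tau> where tot: "has_totals D \<tau>" using bal by (auto simp: balanced_def)
  have "step \<theta> = 1" by (rule step_infinite[OF inf])
  then have pl: "plan \<theta> = bal_proj \<theta>" using fixed_point_plan[OF fp] by simp
  have mg: "marg D (plan \<theta>) m = avg \<theta>" if "m \<in> {1..M}" for m
    using marg_bal_proj[OF that] by (simp add: pl)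
  have "avg (plan \<theta>) = (\<Sum>m=1..M. avg_weight D m *\<^sub>R avg \<theta>)"
    unfolding avg_def[of "plan \<theta>"] avg_marg_def by (intro sum.cong refl) (simp add: mg)
  also have "\<dots> = avg \<theta>" by (simp add: scaleR_left.sum[symmetric] avg_weight_sum del: One_nat_def)
  finally have "avg \<theta> \<in> simplex_of \<tau>" using avg_in_simplex[OF tot plan_in] by metis
  then have feas: "lp_feasible D \<tau> (avg \<theta>) (plan \<theta>)"
    using plan_in mg unfolding lp_feasible_def all_plans_def plans_def
    by (auto simp: marg_def vec_eq_iff)
  have "total_cost D (plan \<theta>) \<le> total_cost D \<pi>'" if "lp_feasible D \<tau> p' \<pi>'" for p' \<pi>'
  proof -
    have y: "\<pi>' \<in> all_plans" using that by (auto simp: lp_feasible_def all_plans_def plans_def)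
    have "marg D \<pi>' m = p'" if "m \<in> {1..M}" for m
      using \<open>lp_feasible D \<tau> p' \<pi>'\<close> that by (auto simp: lp_feasible_def marg_def vec_eq_iff)
    then have "\<pi>' \<in> bal_space D" using M_pos by (simp add: bal_space_iff)
    then show ?thesis
      using fixed_point_optimal[OF fp y] by (simp add: inner_diff_right dual_orthogonal pl bal_proj_in)
  qed
  then show ?thesis unfolding balanced_barycenter_def using tot feas by blast
qed

lemma unbalanced_barycenter_of_fixed_point:
  assumes fp: "dr \<theta> = \<theta>" and g: "\<gamma> = ereal g"
  shows "unbalanced_barycenter D g (avg \<theta>)"
proof -
  have "solves_unbalanced D g (plan \<theta>)"
    using plan_in[of \<theta>] unbalanced_optimal[OF fp g] unfolding solves_unbalanced_def all_plans_def by blast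
  then show ?thesis
    unfolding unbalanced_barycenter_def closest_point_bal_space
    using fixed_point_bal_proj[OF fp] marg_bal_proj by (metis)
qed

section \<open>Block updates and convergence\<close>

definition block_step :: "nat set \<Rightarrow> real ^ 't ^ 'r \<Rightarrow> real ^ 't ^ 'r" where
  "block_step A \<theta> = (\<chi> r c. if block_of c \<in> A then dr \<theta> $ r $ c else \<theta> $ r $ c)"

lemma marg_block_step_other:
  "m \<in> {1..M} \<Longrightarrow> m \<notin> A \<Longrightarrow> marg D (block_step A \<theta>) m = marg D \<theta> m"
  by (simp add: marg_def block_step_def vec_eq_iff)

lemma next_theta_eq:
  assumes pm: "\<And>m. m \<in> {1..M} \<Longrightarrow> pm m = marg D \<theta> m"
  shows "next_theta D \<rho> \<gamma> A \<theta> pm = block_step A \<theta>"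
proof -
  have am: "avg_marg D pm = avg \<theta>"
    unfolding avg_marg_def avg_def by (intro sum.cong refl) (simp add: pm)
  have md: "marg_dev D pm = marg_dev D (marg D \<theta>)"
    unfolding marg_dev_def am avg_def[symmetric] by (intro arg_cong[of _ _ sqrt] sum.cong refl) (simp add: pm)
  have st: "step_size D \<rho> \<gamma> pm = step \<theta>" by (simp add: step_size_def md step_def)
  have pc: "proj_column D \<rho> \<gamma> \<theta> pm m s = proj_column D \<rho> \<gamma> \<theta> (marg D \<theta>) m s" if "m \<in> {1..M}" for m s
    unfolding proj_column_def st am by (simp add: pm[OF that] avg_def step_def)
  have "next_theta D \<rho> \<gamma> A \<theta> pm $ r $ c = block_step A \<theta> $ r $ c" for r c
  proof (rule column_cases[of c])
    fix m s assume *: "m \<in> {1..M}" "s \<in> {1..S m}" "c = col D m s"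
    then show ?thesis
      by (simp add: next_theta_def block_step_def st am pc pm dr_def plan_col dual_col)
  qed
  then show ?thesis by (simp add: vec_eq_iff)
qed

text \<open>
  The stored marginals are those of the current matrix, as updating a block leaves the marginals
  of the other blocks alone.  Only indices in \<open>{1..M}\<close> matter: outside, \<open>col\<close> is unspecified.
\<close>

lemma mam_state_eq:
  "fst (mam_state D \<rho> \<gamma> (\<lambda>k. A (i k)) \<theta>0 n) = fold (\<lambda>j. block_step (A j)) (map i [0..<n]) \<theta>0 \<and>
   (\<forall>m\<in>{1..M}. snd (mam_state D \<rho> \<gamma> (\<lambda>k. A (i k)) \<theta>0 n) m
      = marg D (fold (\<lambda>j. block_step (A j)) (map i [0..<n]) \<theta>0) m)"
proof (induction n)
  case (Suc n)
  define st where "st = mam_state D \<rho> \<gamma> (\<lambda>k. A (i k)) \<theta>0 n"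
  define x where "x = fold (\<lambda>j. block_step (A j)) (map i [0..<n]) \<theta>0"
  have fs: "fst st = x" and ss: "\<And>m. m \<in> {1..M} \<Longrightarrow> snd st m = marg D x m"
    using Suc.IH by (auto simp: st_def x_def)
  have nt: "next_theta D \<rho> \<gamma> (A (i n)) x (snd st) = block_step (A (i n)) x"
    by (rule next_theta_eq[OF ss])
  have st': "mam_state D \<rho> \<gamma> (\<lambda>k. A (i k)) \<theta>0 (Suc n) = mam_step D \<rho> \<gamma> (A (i n)) st"
    by (simp add: st_def)
  have x': "fold (\<lambda>j. block_step (A j)) (map i [0..<Suc n]) \<theta>0 = block_step (A (i n)) x"
    by (simp add: x_def)
  show ?case
    unfolding st' x' mam_step_def Let_def fs nt using ss by (auto simp: marg_block_step_other)
qed simp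

lemma mam_p_eq:
  "mam_p D \<rho> \<gamma> (\<lambda>k. A (i k)) \<theta>0 n = avg (fold (\<lambda>j. block_step (A j)) (map i [0..<n]) \<theta>0)"
  unfolding mam_p_def avg_def avg_marg_def using mam_state_eq[of A i \<theta>0 n]
  by (intro sum.cong refl) simp

lemma avg_continuous: "continuous_on UNIV avg"
  unfolding avg_def[abs_def] avg_marg_def marg_def by (intro continuous_intros)

text \<open>
  With weight \<open>1 / \<beta> i\<close> on block \<open>i\<close>, the probability \<open>\<beta> i\<close> of updating the block cancels its weight, and the
  expected change of \<open>V\<close> is the unweighted change of the squared distance under the full operator
  \<open>dr\<close>.
\<close>

lemma block_random_fejer:
  assumes pw: "prob_weights \<beta> J" and \<beta>: "\<And>i. i \<in> J \<Longrightarrow> 0 < \<beta> i"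
    and cover: "(\<Union>i\<in>J. A i) = {1..M}" and disj: "disjoint_family_on A J"
    and ex: "\<exists>\<theta>. dr \<theta> = \<theta>"
  shows "\<exists>V C. random_fejer \<beta> J (\<lambda>i. block_step (A i)) {\<theta>. dr \<theta> = \<theta>} V (\<lambda>x. (norm (dr x - x))\<^sup>2) 1 C"
proof -
  interpret prob_weights \<beta> J by fact
  have "\<forall>c. \<exists>i. i \<in> J \<and> block_of c \<in> A i" using cover block_of_range by blast
  then obtain b where b: "\<And>c. b c \<in> J" "\<And>c. block_of c \<in> A (b c)" by metis
  have b_iff: "block_of c \<in> A i \<longleftrightarrow> i = b c" if "i \<in> J" for i c
    using b[of c] disj that by (auto simp: disjoint_family_on_def)
  define V :: "real ^ 't ^ 'r \<Rightarrow> real ^ 't ^ 'r \<Rightarrow> real" where "V = weighted_sq (\<lambda>c. 1 / \<beta> (b c))"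
  define C where "C = (\<Sum>i\<in>J. 1 / \<beta> i)"
  have wC: "1 / \<beta> (b c) \<le> C" for c
    unfolding C_def by (rule member_le_sum) (use b \<beta> finite_J in \<open>auto simp: less_imp_le\<close>)
  have w1: "1 \<le> 1 / \<beta> (b c)" for c
  proof -
    have "\<beta> (b c) \<le> (\<Sum>i\<in>J. \<beta> i)" by (rule member_le_sum) (use b \<beta>_nonneg finite_J in auto)
    then show ?thesis using \<beta>[OF b(1)[of c]] \<beta>_sum by simp
  qed
  have "random_fejer \<beta> J (\<lambda>i. block_step (A i)) {\<theta>. dr \<theta> = \<theta>} V (\<lambda>x. (norm (dr x - x))\<^sup>2) 1 C"
  proof unfold_locales
    show "closed {\<theta>. dr \<theta> = \<theta>}"
      by (intro closed_Collect_eq dr_continuous continuous_on_id)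
    show "{\<theta>. dr \<theta> = \<theta>} \<noteq> {}" using ex by auto
    show "0 < C" using w1 wC by (meson less_le_trans zero_less_one)
    show "continuous_on UNIV (\<lambda>x. (norm (dr x - x))\<^sup>2)" by (intro continuous_intros dr_continuous)
    fix x z :: "real ^ 't ^ 'r"
    show "1 * (dist x z)\<^sup>2 \<le> V x z"
      unfolding dist_sq_eq V_def weighted_sq_def mult_1
      using mult_right_mono[OF w1, of "\<Sum>r\<in>UNIV. (x $ r $ c - z $ r $ c)\<^sup>2" for c]
      by (intro sum_mono) (simp add: sum_nonneg)
    show "V x z \<le> C * (dist x z)\<^sup>2"
    proof -
      have "V x z \<le> (\<Sum>c\<in>UNIV. C * (\<Sum>r\<in>UNIV. (x $ r $ c - z $ r $ c)\<^sup>2))"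
        unfolding V_def weighted_sq_def by (intro sum_mono mult_right_mono wC sum_nonneg) auto
      then show ?thesis unfolding dist_sq_eq by (simp only: sum_distrib_left[symmetric])
    qed
    show "(norm (dr x - x))\<^sup>2 = 0 \<Longrightarrow> x \<in> {\<theta>. dr \<theta> = \<theta>}" by simp
    assume "z \<in> {\<theta>. dr \<theta> = \<theta>}"
    then have z: "dr z = z" by simp
    define e where "e c = (\<Sum>r\<in>UNIV. (x $ r $ c - z $ r $ c)\<^sup>2)" for c
    define e' where "e' c = (\<Sum>r\<in>UNIV. (dr x $ r $ c - z $ r $ c)\<^sup>2)" for c
    \<comment> \<open>\<open>e\<close> and \<open>e'\<close>: squared distances of a column to \<open>z\<close> before and after a full update.\<close>
    have Vi: "V (block_step (A i) x) z = V x z + (\<Sum>c\<in>UNIV. if i = b c then (e' c - e c) / \<beta> i else 0)"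
      if i: "i \<in> J" for i
    proof -
      have "V (block_step (A i) x) z = (\<Sum>c\<in>UNIV. 1 / \<beta> (b c) * (if i = b c then e' c else e c))"
        unfolding V_def weighted_sq_def
        by (intro sum.cong refl) (simp add: block_step_def b_iff[OF i] e_def e'_def)
      also have "\<dots> = (\<Sum>c\<in>UNIV. 1 / \<beta> (b c) * e c + (if i = b c then (e' c - e c) / \<beta> i else 0))"
        by (intro sum.cong refl) (simp add: diff_divide_distrib)
      finally show ?thesis by (simp add: sum.distrib V_def weighted_sq_def e_def)
    qed
    have "(\<Sum>i\<in>J. \<beta> i * V (block_step (A i) x) z)
        = (\<Sum>i\<in>J. \<beta> i * V x z + (\<Sum>c\<in>UNIV. if i = b c then e' c - e c else 0))"
    proof (intro sum.cong refl)
      fix i assume i: "i \<in> J"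
      have "\<beta> i * (\<Sum>c\<in>UNIV. if i = b c then (e' c - e c) / \<beta> i else 0) = (\<Sum>c\<in>UNIV. if i = b c then e' c - e c else 0)"
        unfolding sum_distrib_left using \<beta>[OF i] by (intro sum.cong refl) auto
      then show "\<beta> i * V (block_step (A i) x) z = \<beta> i * V x z + (\<Sum>c\<in>UNIV. if i = b c then e' c - e c else 0)"
        by (simp add: Vi[OF i] distrib_left)
    qed
    also have "\<dots> = V x z + (\<Sum>i\<in>J. \<Sum>c\<in>UNIV. if i = b c then e' c - e c else 0)"
      by (simp add: sum.distrib sum_distrib_right[symmetric] \<beta>_sum)
    also have "(\<Sum>i\<in>J. \<Sum>c\<in>UNIV. if i = b c then e' c - e c else 0) = (\<Sum>c\<in>UNIV. e' c - e c)"
      by (subst sum.swap) (simp add: b finite_J)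
    also have "\<dots> = (norm (dr x - dr z))\<^sup>2 - (norm (x - z))\<^sup>2"
      by (simp add: sum_subtractf norm_matrix_sq e_def e'_def z)
    also have "V x z + \<dots> \<le> V x z - (norm (dr x - x))\<^sup>2"
      using dr_firm[of x z] by (simp add: z norm_minus_commute)
    finally show "(\<Sum>i\<in>J. \<beta> i * V (block_step (A i) x) z) \<le> V x z - (norm (dr x - x))\<^sup>2" .
  qed simp_all
  then show ?thesis by blast
qed

lemma mam_AE_converges:
  fixes P :: "'w measure" and I :: "nat \<Rightarrow> 'w \<Rightarrow> 'i::countable"
  assumes draws: "iid_draws \<beta> J P I" and \<beta>: "\<And>i. i \<in> J \<Longrightarrow> 0 < \<beta> i"
    and cover: "(\<Union>i\<in>J. A i) = {1..M}" and disj: "disjoint_family_on A J"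
    and ex: "\<exists>\<theta>. dr \<theta> = \<theta>"
  shows "AE \<omega> in P. \<exists>\<theta>. dr \<theta> = \<theta> \<and> mam_p D \<rho> \<gamma> (\<lambda>k. A (I k \<omega>)) \<theta>0 \<longlonglongrightarrow> avg \<theta>"
proof -
  interpret iid_draws \<beta> J P I by fact
  have "prob_weights \<beta> J" by unfold_locales
  from block_random_fejer[OF this \<beta> cover disj ex] obtain V C
    where "random_fejer \<beta> J (\<lambda>i. block_step (A i)) {\<theta>. dr \<theta> = \<theta>} V (\<lambda>x. (norm (dr x - x))\<^sup>2) 1 C"
    by blast
  then interpret random_fejer \<beta> J "\<lambda>i. block_step (A i)" "{\<theta>. dr \<theta> = \<theta>}" V "\<lambda>x. (norm (dr x - x))\<^sup>2" 1 C .
  interpret random_fejer_process \<beta> J "\<lambda>i. block_step (A i)" "{\<theta>. dr \<theta> = \<theta>}" V "\<lambda>x. (norm (dr x - x))\<^sup>2" 1 C P I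
    by unfold_locales
  from AE_converges[of \<theta>0] show ?thesis
  proof eventually_elim
    fix \<omega>
    assume "\<exists>z\<in>{\<theta>. dr \<theta> = \<theta>}. (\<lambda>k. fold (\<lambda>i. block_step (A i)) (map (\<lambda>k. I k \<omega>) [0..<k]) \<theta>0) \<longlonglongrightarrow> z"
    then obtain z where z: "dr z = z"
      "(\<lambda>k. fold (\<lambda>i. block_step (A i)) (map (\<lambda>k. I k \<omega>) [0..<k]) \<theta>0) \<longlonglongrightarrow> z" by auto
    have "isCont avg z" using avg_continuous by (simp add: continuous_on_eq_continuous_at)
    moreover have "mam_p D \<rho> \<gamma> (\<lambda>k. A (I k \<omega>)) \<theta>0
        = (\<lambda>n. avg (fold (\<lambda>i. block_step (A i)) (map (\<lambda>k. I k \<omega>) [0..<n]) \<theta>0))"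
      by (intro ext mam_p_eq)
    ultimately have "mam_p D \<rho> \<gamma> (\<lambda>k. A (I k \<omega>)) \<theta>0 \<longlonglongrightarrow> avg z"
      using isCont_tendsto_compose[OF _ z(2)] by simp
    then show "\<exists>\<theta>. dr \<theta> = \<theta> \<and> mam_p D \<rho> \<gamma> (\<lambda>k. A (I k \<omega>)) \<theta>0 \<longlonglongrightarrow> avg \<theta>" using z(1) by blast
  qed
qed

lemma mam_p_measurable:
  assumes "iid_draws \<beta> J P I"
  shows "(\<lambda>\<omega>. mam_p D \<rho> \<gamma> (\<lambda>k. A (I k \<omega>)) \<theta>0 n) \<in> borel_measurable P"
proof -
  interpret iid_draws \<beta> J P I by fact
  have "(\<lambda>\<omega>. mam_p D \<rho> \<gamma> (\<lambda>k. A (I k \<omega>)) \<theta>0 n)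
      = (\<lambda>\<omega>. avg (fold (\<lambda>i. block_step (A i)) (map (\<lambda>k. I k \<omega>) [0..<n]) \<theta>0))"
    by (intro ext mam_p_eq)
  also have "\<dots> \<in> borel_measurable P" by (rule measurable_compose[OF prefix_measurable]) simp
  finally show ?thesis .
qed

end

section \<open>The two laws of the draws\<close>

text \<open>
  Drawing the only element of \<open>unit\<close> turns the deterministic algorithm into a randomised one.
\<close>

lemma iid_draws_trivial:
  "iid_draws (\<lambda>_::unit. 1) {()} (return (count_space UNIV) ()) (\<lambda>(k::nat) (\<omega>::unit). ())"
proof -
  interpret prob_space "return (count_space UNIV) ()"
    by (rule prob_space_return) simp
  show ?thesis
  proof unfold_locales
    fix w :: "unit list" assume "set w \<subseteq> {()}"
    have "map (\<lambda>k::nat. ()) [0..<length w] = w" by (rule nth_equalityI) auto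
    moreover have "prod_list (map (\<lambda>_. 1) w) = (1::real)" by (induction w) auto
    ultimately show "prob {\<omega> \<in> space (return (count_space UNIV) ()). map (\<lambda>k::nat. ()) [0..<length w] = w}
        = prod_list (map (\<lambda>_. 1) w)"
      using prob_space by simp
  qed auto
qed

lemma (in prob_space) iid_draws_of_indep_vars:
  fixes I :: "nat \<Rightarrow> 'a \<Rightarrow> 'i::countable"
  assumes indep: "indep_vars (\<lambda>k. count_space UNIV) I UNIV"
    and weights: "prob_weights \<beta> J"
    and law: "\<And>k i. i \<in> J \<Longrightarrow> prob {\<omega> \<in> space M. I k \<omega> = i} = \<beta> i"
  shows "iid_draws \<beta> J M I"
proof -
  interpret prob_weights \<beta> J by fact
  show ?thesis
  proof unfold_locales
    show "I k \<in> measurable M (count_space UNIV)" for k using indep by (auto simp: indep_vars_def)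
    fix w assume w: "set w \<subseteq> J"
    show "prob {\<omega> \<in> space M. map (\<lambda>k. I k \<omega>) [0..<length w] = w} = prod_list (map \<beta> w)"
    proof (cases "w = []")
      case True
      then show ?thesis by (simp add: prob_space)
    next
      case False
      have iff: "map (\<lambda>k. I k \<omega>) [0..<length w] = w \<longleftrightarrow> (\<forall>k<length w. I k \<omega> = w ! k)" for \<omega>
        by (subst list_eq_iff_nth_eq) simp
      have "{\<omega> \<in> space M. map (\<lambda>k. I k \<omega>) [0..<length w] = w}
          = (\<Inter>k\<in>{..<length w}. I k -` {w ! k} \<inter> space M)"
        unfolding iff using False by auto
      also have "prob \<dots> = (\<Prod>k<length w. prob (I k -` {w ! k} \<inter> space M))"
        using False by (intro indep_varsD[OF indep]) auto
      also have "\<dots> = (\<Prod>k<length w. \<beta> (w ! k))"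
      proof (intro prod.cong refl)
        fix k assume "k \<in> {..<length w}"
        then have "w ! k \<in> J" using w by auto
        from law[OF this, of k] show "prob (I k -` {w ! k} \<inter> space M) = \<beta> (w ! k)"
          by (simp add: vimage_def Int_def conj_commute)
      qed
      also have "\<dots> = prod_list (map \<beta> w)"
        by (subst prod.list_conv_set_nth) (simp add: atLeast0LessThan)
      finally show ?thesis .
    qed
  qed
qed

section \<open>Convergence of the method of averaged marginals\<close>

theorem theorem4:
  fixes D :: "('d::finite, 'r::finite, 't::finite) wb_data"
    and \<rho> :: real and \<gamma> :: ereal and \<theta>0 :: "real ^ 't ^ 'r"
  assumes "valid_data D"
    and "\<rho> > 0"
    and "balanced D \<Longrightarrow> \<gamma> = \<infinity>"
    and "\<not> balanced D \<Longrightarrow> 0 < \<gamma> \<and> \<gamma> < \<infinity>"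
  shows
    "(\<exists>pbar. mam_p D \<rho> \<gamma> (\<lambda>k. {1..nmeas D}) \<theta>0 \<longlonglongrightarrow> pbar \<and>
        (if balanced D then balanced_barycenter D pbar
         else unbalanced_barycenter D (real_of_ereal \<gamma>) pbar))
     \<and>
     (\<forall>(nb::nat) (A :: nat \<Rightarrow> nat set) (\<beta> :: nat \<Rightarrow> real) (P :: 'w measure) (I :: nat \<Rightarrow> 'w \<Rightarrow> nat).
        1 < nb \<and> nb < nmeas D \<and>
        (\<Union>i\<in>{1..nb}. A i) = {1..nmeas D} \<and> disjoint_family_on A {1..nb} \<and>
        (\<forall>i\<in>{1..nb}. \<beta> i = (\<Sum>m\<in>A i. wt D m) \<and> \<beta> i > 0) \<and>
        prob_space P \<and>
        prob_space.indep_vars P (\<lambda>k. count_space UNIV) I UNIV \<and>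
        (\<forall>k. \<forall>i\<in>{1..nb}. measure P {\<omega> \<in> space P. I k \<omega> = i} = \<beta> i)
        \<longrightarrow>
        (\<exists>pbar \<in> borel_measurable P.
           (AE \<omega> in P. mam_p D \<rho> \<gamma> (\<lambda>k. A (I k \<omega>)) \<theta>0 \<longlonglongrightarrow> pbar \<omega>) \<and>
           (if balanced D then AE \<omega> in P. balanced_barycenter D (pbar \<omega>)
            else AE \<omega> in P. unbalanced_barycenter D (real_of_ereal \<gamma>) (pbar \<omega>))))"
proof (intro conjI allI impI)
  have \<gamma>: "0 < \<gamma>" using assms(3,4) by (cases "balanced D") auto
  interpret mam D \<rho> \<gamma> by unfold_locales (use assms(1,2) \<gamma> in auto)
  have ex: "\<exists>\<theta>. dr \<theta> = \<theta>"
  proof (cases "balanced D")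
    case True
    then show ?thesis using fixed_point_balanced assms(3) by blast
  next
    case False
    then obtain g where "\<gamma> = ereal g" using assms(4) by (cases \<gamma>) auto
    then show ?thesis by (rule fixed_point_finite)
  qed
  have optimal: "if balanced D then balanced_barycenter D (avg \<theta>)
      else unbalanced_barycenter D (real_of_ereal \<gamma>) (avg \<theta>)" if fp: "dr \<theta> = \<theta>" for \<theta>
  proof (cases "balanced D")
    case True
    then show ?thesis using balanced_barycenter_of_fixed_point[OF fp] assms(3) by simp
  next
    case False
    then obtain g where g: "\<gamma> = ereal g" using assms(4) by (cases \<gamma>) auto
    then have "real_of_ereal \<gamma> = g" by simp
    then show ?thesis using unbalanced_barycenter_of_fixed_point[OF fp g] False by metis
  qed
  {
    have "AE \<omega> in return (count_space UNIV) ().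
        \<exists>\<theta>. dr \<theta> = \<theta> \<and> mam_p D \<rho> \<gamma> (\<lambda>k. {1..M}) \<theta>0 \<longlonglongrightarrow> avg \<theta>"
      using mam_AE_converges[where A = "\<lambda>_. {1..M}", OF iid_draws_trivial _ _ _ ex]
      by (simp add: disjoint_family_on_def)
    then obtain \<theta> where \<theta>: "dr \<theta> = \<theta>" "mam_p D \<rho> \<gamma> (\<lambda>k. {1..M}) \<theta>0 \<longlonglongrightarrow> avg \<theta>"
      using prob_space.AE_const[OF prob_space_return] by (auto simp: AE_return)
    then show "\<exists>pbar. mam_p D \<rho> \<gamma> (\<lambda>k. {1..nmeas D}) \<theta>0 \<longlonglongrightarrow> pbar \<and>
        (if balanced D then balanced_barycenter D pbar
         else unbalanced_barycenter D (real_of_ereal \<gamma>) pbar)"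
      using optimal by blast
  next
    fix nb A \<beta> and P :: "'w measure" and I :: "nat \<Rightarrow> 'w \<Rightarrow> nat"
    assume *: "1 < nb \<and> nb < nmeas D \<and>
        (\<Union>i\<in>{1..nb}. A i) = {1..nmeas D} \<and> disjoint_family_on A {1..nb} \<and>
        (\<forall>i\<in>{1..nb}. \<beta> i = (\<Sum>m\<in>A i. wt D m) \<and> \<beta> i > 0) \<and>
        prob_space P \<and>
        prob_space.indep_vars P (\<lambda>k. count_space UNIV) I UNIV \<and>
        (\<forall>k. \<forall>i\<in>{1..nb}. measure P {\<omega> \<in> space P. I k \<omega> = i} = \<beta> i)"
    then have cover: "(\<Union>i\<in>{1..nb}. A i) = {1..M}" and disj: "disjoint_family_on A {1..nb}"
      and \<beta>: "\<And>i. i \<in> {1..nb} \<Longrightarrow> \<beta> i = (\<Sum>m\<in>A i. wt D m)" "\<And>i. i \<in> {1..nb} \<Longrightarrow> 0 < \<beta> i"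
      and indep: "prob_space.indep_vars P (\<lambda>k. count_space UNIV) I UNIV"
      and law: "\<And>k i. i \<in> {1..nb} \<Longrightarrow> measure P {\<omega> \<in> space P. I k \<omega> = i} = \<beta> i"
      by blast+
    interpret prob_space P using * by blast
    have "(\<Sum>i\<in>{1..nb}. \<beta> i) = (\<Sum>i\<in>{1..nb}. \<Sum>m\<in>A i. wt D m)"
      by (intro sum.cong refl \<beta>(1))
    also have "\<dots> = (\<Sum>m\<in>(\<Union>i\<in>{1..nb}. A i). wt D m)"
    proof (rule sum.UNION_disjoint[symmetric])
      show "\<forall>i\<in>{1..nb}. finite (A i)"
        using cover by (metis UN_upper finite_atLeastAtMost finite_subset)
      show "\<forall>i\<in>{1..nb}. \<forall>j\<in>{1..nb}. i \<noteq> j \<longrightarrow> A i \<inter> A j = {}"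
        using disj unfolding disjoint_family_on_def by blast
    qed simp
    also have "\<dots> = 1" using assms(1) unfolding cover valid_data_def by blast
    finally have "prob_weights \<beta> {1..nb}"
      by unfold_locales (use \<beta>(2) in \<open>auto simp: less_imp_le\<close>)
    from iid_draws_of_indep_vars[OF indep this law]
    have draws: "iid_draws \<beta> {1..nb} P I" .
    define pbar where "pbar \<omega> = lim (mam_p D \<rho> \<gamma> (\<lambda>k. A (I k \<omega>)) \<theta>0)" for \<omega>
    have meas: "pbar \<in> borel_measurable P"
      unfolding pbar_def by (intro borel_measurable_lim_metric mam_p_measurable[OF draws])
    have "AE \<omega> in P. \<exists>\<theta>. dr \<theta> = \<theta> \<and> mam_p D \<rho> \<gamma> (\<lambda>k. A (I k \<omega>)) \<theta>0 \<longlonglongrightarrow> avg \<theta>"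
      by (rule mam_AE_converges[OF draws \<beta>(2) cover disj ex])
    then have lim: "AE \<omega> in P. mam_p D \<rho> \<gamma> (\<lambda>k. A (I k \<omega>)) \<theta>0 \<longlonglongrightarrow> pbar \<omega> \<and> (\<exists>\<theta>. dr \<theta> = \<theta> \<and> pbar \<omega> = avg \<theta>)"
    proof eventually_elim
      fix \<omega>
      assume "\<exists>\<theta>. dr \<theta> = \<theta> \<and> mam_p D \<rho> \<gamma> (\<lambda>k. A (I k \<omega>)) \<theta>0 \<longlonglongrightarrow> avg \<theta>"
      then obtain \<theta> where \<theta>: "dr \<theta> = \<theta>" "mam_p D \<rho> \<gamma> (\<lambda>k. A (I k \<omega>)) \<theta>0 \<longlonglongrightarrow> avg \<theta>" by blast
      then have "pbar \<omega> = avg \<theta>" unfolding pbar_def by (intro limI)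
      with \<theta> show "mam_p D \<rho> \<gamma> (\<lambda>k. A (I k \<omega>)) \<theta>0 \<longlonglongrightarrow> pbar \<omega> \<and> (\<exists>\<theta>. dr \<theta> = \<theta> \<and> pbar \<omega> = avg \<theta>)"
        by auto
    qed
    show "\<exists>pbar \<in> borel_measurable P.
           (AE \<omega> in P. mam_p D \<rho> \<gamma> (\<lambda>k. A (I k \<omega>)) \<theta>0 \<longlonglongrightarrow> pbar \<omega>) \<and>
           (if balanced D then AE \<omega> in P. balanced_barycenter D (pbar \<omega>)
            else AE \<omega> in P. unbalanced_barycenter D (real_of_ereal \<gamma>) (pbar \<omega>))"
    proof (intro bexI[OF _ meas] conjI)
      show "AE \<omega> in P. mam_p D \<rho> \<gamma> (\<lambda>k. A (I k \<omega>)) \<theta>0 \<longlonglongrightarrow> pbar \<omega>" using lim by auto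
      have "AE \<omega> in P. if balanced D then balanced_barycenter D (pbar \<omega>)
          else unbalanced_barycenter D (real_of_ereal \<gamma>) (pbar \<omega>)"
        using lim
      proof eventually_elim
        fix \<omega>
        assume "mam_p D \<rho> \<gamma> (\<lambda>k. A (I k \<omega>)) \<theta>0 \<longlonglongrightarrow> pbar \<omega> \<and> (\<exists>\<theta>. dr \<theta> = \<theta> \<and> pbar \<omega> = avg \<theta>)"
        then show "if balanced D then balanced_barycenter D (pbar \<omega>)
          else unbalanced_barycenter D (real_of_ereal \<gamma>) (pbar \<omega>)" using optimal by metis
      qed
      then show "if balanced D then AE \<omega> in P. balanced_barycenter D (pbar \<omega>)
            else AE \<omega> in P. unbalanced_barycenter D (real_of_ereal \<gamma>) (pbar \<omega>)"
        by (cases "balanced D") simp_all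
    qed
  }
qed

end
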